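(* Consider the linear model $Y=Xw+u$ with $Y,u\in\mathbb R^T$, $X\in\mathbb R^{T\times J}$, $T=T_0+T_*$, and the estimator $\hat w\in\arg\min_{v\in\mathcal W}\|Y-Xv\|_2$, where $\mathcal W\subseteq\{v\in\mathbb R^J:\|v\|_1\le K\}$ and $K$ is bounded. Write $X_{jt}$ for the value of the $j$-th regressor at time $t$ and $X_t=(X_{1t},\dots,X_{Jt})'$. Assume: (1) $E(u_tX_{jt})=0$ for $1\le j\le J$; (2) there are constants $c_1,c_2>0$ such that $E|X_{jt}u_t|^2\ge c_1$ and $E|X_{jt}u_t|^3\le c_2$ for all $1\le j\le J$, $1\le t\le T$; (3) for each $1\le j\le J$, the sequence $\{X_{jt}u_t\}_{t=1}^T$ is $\beta$-mixing with coefficients satisfying $\beta(t)\le a_1\exp(-a_2t^\tau)$, where $a_1,a_2,\tau>0$ are constants; (4) there is a constant $c_3>0$ such that $\max_{1\le j\le J}\sum_{t=1}^TX_{jt}^2u_t^2\le c_3^2T$ with probability $1-o(1)$; (5) $\log J=o(T^{4\tau/(3\tau+4)})$ and $w\in\mathcal W$. Then there is a constant $M>0$ depending only on $K$ and the constants above such that, with probability $1-o(1)$, $$\|X(\hat w-w)\|_2^2/T\le B_T:=M[\log(T\vee J)]^{(1+\tau)/(2\tau)}T^{-1/2}.$$ If, moreover, (6) there is a sequence $\ell_T>0$ such that, with probability $1-o(1)$, $(X_t'\delta)^2\le\ell_T\|X\delta\|_2^2/T$ for all $\delta$ with $w+\delta\in\mathcal W$ and for $T_0+1\le t\le T$; and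 (7) $\ell_TB_T\to0$, then, with $P_t^N=X_t'w$ and $\hat P_t^N=X_t'\hat w$, $$\frac1T\sum_{t=1}^T(\hat P_t^N-P_t^N)^2=o_P(1)\quad\text{and}\quad\hat P_t^N-P_t^N=o_P(1)\ \text{ for any }T_0+1\le t\le T.$$
   Context: Asymptotics are as $T_0\to\infty$ and $J=J_T\to\infty$, with $T_0$ pre-treatment and $T_*$ post-treatment periods. $a\vee b=\max\{a,b\}$. Special cases: the synthetic control estimator has $\mathcal W=\{v\ge0,\|v\|_1=1\}$; the constrained Lasso has $\mathcal W=\{v:\|v\|_1\le K\}$.
   Formalization: The claim that the average squared prediction error is o_P(1) is proved under the extra assumption B_T→0, without which it can fail (ℓ_T may tend to 0 while B_T diverges); M is chosen after fixing the set from which sample points are drawn. *)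

theory Defs
  imports "HOL-Probability.Probability" "HOL-Library.Landau_Symbols"
begin

text \<open>
  The dimensions change along the asymptotic sequence, so vectors are functions on \<^typ>\<open>nat\<close>
  and \<open>\<real>\<^sup>J\<close> is the space of those functions that vanish off \<open>{1..J}\<close>. A design matrix is a
  function \<open>x\<close>, where \<open>x j t\<close> is the value of regressor \<open>j\<close> at time \<open>t\<close>.
\<close>

definition Rvec :: "nat \<Rightarrow> (nat \<Rightarrow> real) set" where
  "Rvec J = {v. \<forall>j. j \<notin> {1..J} \<longrightarrow> v j = 0}"

definition l1_norm :: "nat \<Rightarrow> (nat \<Rightarrow> real) \<Rightarrow> real" where
  "l1_norm J v = (\<Sum>j=1..J. \<bar>v j\<bar>)"

text \<open>The entry \<open>X\<^sub>t' v\<close> of \<open>X v\<close> at time \<open>t\<close>.\<close>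

definition mat_vec :: "nat \<Rightarrow> (nat \<Rightarrow> nat \<Rightarrow> real) \<Rightarrow> (nat \<Rightarrow> real) \<Rightarrow> nat \<Rightarrow> real" where
  "mat_vec J x v t = (\<Sum>j=1..J. x j t * v j)"

text \<open>
  Coefficient of absolute regularity of two \<open>\<sigma>\<close>-algebras \<open>\<A>\<close>, \<open>\<B>\<close> of events of a
  probability space: half the supremum of \<open>\<Sum>\<^sub>A \<Sum>\<^sub>B \<bar>P(A \<inter> B) - P(A) P(B)\<bar>\<close> over all
  finite partitions of the sample space into events of \<open>\<A>\<close> and into events of \<open>\<B>\<close>.
\<close>

definition beta_coeff :: "'a measure \<Rightarrow> 'a set set \<Rightarrow> 'a set set \<Rightarrow> real" where
  "beta_coeff N \<A> \<B> =
    Sup {1 / 2 * (\<Sum>A\<in>P. \<Sum>B\<in>Q. \<bar>measure N (A \<inter> B) - measure N A * measure N B\<bar>) | P Q.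
      finite P \<and> partition_on (space N) P \<and> P \<subseteq> \<A> \<and>
      finite Q \<and> partition_on (space N) Q \<and> Q \<subseteq> \<B>}"

definition generated_events :: "'a measure \<Rightarrow> (nat \<Rightarrow> 'a \<Rightarrow> real) \<Rightarrow> nat set \<Rightarrow> 'a set set" where
  "generated_events N Z I =
    sigma_sets (space N) {Z i -` S \<inter> space N | i S. i \<in> I \<and> S \<in> sets borel}"

text \<open>
  The \<open>\<beta>\<close>-mixing coefficient at lag \<open>m \<ge> 1\<close> of a finite sequence \<open>Z 1, \<dots>, Z T\<close>. If one of
  the two index sets is empty, it generates the trivial \<open>\<sigma>\<close>-algebra and contributes \<open>0\<close>;
  in particular the coefficient is \<open>0\<close> for \<open>m \<ge> T\<close>.
\<close>

definition beta_mixing :: "'a measure \<Rightarrow> nat \<Rightarrow> (nat \<Rightarrow> 'a \<Rightarrow> real) \<Rightarrow> nat \<Rightarrow> real" where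
  "beta_mixing N T Z m =
    (SUP k\<in>{..T}. beta_coeff N (generated_events N Z {1..k}) (generated_events N Z {k+m..T}))"

text \<open>``With probability \<open>1 - o(1)\<close>'' and \<open>o\<^sub>P(1)\<close>, along a sequence of probability spaces.\<close>

definition whp :: "(nat \<Rightarrow> 'a measure) \<Rightarrow> (nat \<Rightarrow> 'a \<Rightarrow> bool) \<Rightarrow> bool" where
  "whp \<Omega> E \<longleftrightarrow> (\<lambda>n. \<P>(\<omega> in \<Omega> n. E n \<omega>)) \<longlonglongrightarrow> 1"

definition oP1 :: "(nat \<Rightarrow> 'a measure) \<Rightarrow> (nat \<Rightarrow> 'a \<Rightarrow> real) \<Rightarrow> bool" where
  "oP1 \<Omega> Z \<longleftrightarrow> (\<forall>\<epsilon>>0. (\<lambda>n. \<P>(\<omega> in \<Omega> n. \<bar>Z n \<omega>\<bar> > \<epsilon>)) \<longlonglongrightarrow> 0)"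

definition rate :: "real \<Rightarrow> real \<Rightarrow> nat \<Rightarrow> nat \<Rightarrow> real" where
  "rate M \<tau> T J = M * ln (real (max T J)) powr ((1 + \<tau>) / (2 * \<tau>)) * real T powr (- 1 / 2)"

text \<open>
  The index \<open>n\<close> runs along the asymptotic sequence; \<open>X n \<omega> j t\<close> and \<open>u n \<omega> t\<close> are the values
  at the sample point \<open>\<omega>\<close> of \<open>\<Omega> n\<close>, and \<open>wh n \<omega>\<close> is the estimator. The first row of
  parameters consists of the constants, which do not depend on \<open>n\<close>; \<open>Kb\<close> bounds the radii
  \<open>K n\<close>.
\<close>

locale regression_array =
  fixes Kb c1 c2 c3 a1 a2 \<tau> :: real
    and \<Omega> :: "nat \<Rightarrow> 'a measure"
    and T0 Ts T J :: "nat \<Rightarrow> nat"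
    and X :: "nat \<Rightarrow> 'a \<Rightarrow> nat \<Rightarrow> nat \<Rightarrow> real"
    and u Y :: "nat \<Rightarrow> 'a \<Rightarrow> nat \<Rightarrow> real"
    and K :: "nat \<Rightarrow> real"
    and W :: "nat \<Rightarrow> (nat \<Rightarrow> real) set"
    and w :: "nat \<Rightarrow> nat \<Rightarrow> real"
    and wh :: "nat \<Rightarrow> 'a \<Rightarrow> nat \<Rightarrow> real"
  assumes prob_space: "\<And>n. prob_space (\<Omega> n)"
    and T_eq: "\<And>n. T n = T0 n + Ts n"
    and T0_infinity: "filterlim T0 at_top sequentially"
    and J_infinity: "filterlim J at_top sequentially"
    and X_measurable: "\<And>n j t. j \<in> {1..J n} \<Longrightarrow> t \<in> {1..T n} \<Longrightarrow>
          (\<lambda>\<omega>. X n \<omega> j t) \<in> borel_measurable (\<Omega> n)"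
    and u_measurable: "\<And>n t. t \<in> {1..T n} \<Longrightarrow> (\<lambda>\<omega>. u n \<omega> t) \<in> borel_measurable (\<Omega> n)"
    and model: "\<And>n \<omega> t. \<omega> \<in> space (\<Omega> n) \<Longrightarrow> t \<in> {1..T n} \<Longrightarrow>
          Y n \<omega> t = mat_vec (J n) (X n \<omega>) (w n) t + u n \<omega> t"
    and W_bounded: "\<And>n. W n \<subseteq> {v \<in> Rvec (J n). l1_norm (J n) v \<le> K n}"
    and K_bounded: "\<And>n. K n \<le> Kb"
    and wh_measurable: "\<And>n j. j \<in> {1..J n} \<Longrightarrow> (\<lambda>\<omega>. wh n \<omega> j) \<in> borel_measurable (\<Omega> n)"
    and wh_arg_min: "\<And>n \<omega>. \<omega> \<in> space (\<Omega> n) \<Longrightarrow>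
          is_arg_min (\<lambda>v. L2_set (\<lambda>t. Y n \<omega> t - mat_vec (J n) (X n \<omega>) v t) {1..T n})
            (\<lambda>v. v \<in> W n) (wh n \<omega>)"
    and mean_zero: "\<And>n j t. j \<in> {1..J n} \<Longrightarrow> t \<in> {1..T n} \<Longrightarrow>
          integrable (\<Omega> n) (\<lambda>\<omega>. u n \<omega> t * X n \<omega> j t) \<and>
          (\<integral>\<omega>. u n \<omega> t * X n \<omega> j t \<partial>\<Omega> n) = 0"
    and second_moment: "\<And>n j t. j \<in> {1..J n} \<Longrightarrow> t \<in> {1..T n} \<Longrightarrow>
          (\<integral>\<omega>. \<bar>X n \<omega> j t * u n \<omega> t\<bar> ^ 2 \<partial>\<Omega> n) \<ge> c1"
    and third_moment: "\<And>n j t. j \<in> {1..J n} \<Longrightarrow> t \<in> {1..T n} \<Longrightarrow>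
          integrable (\<Omega> n) (\<lambda>\<omega>. \<bar>X n \<omega> j t * u n \<omega> t\<bar> ^ 3) \<and>
          (\<integral>\<omega>. \<bar>X n \<omega> j t * u n \<omega> t\<bar> ^ 3 \<partial>\<Omega> n) \<le> c2"
    and mixing: "\<And>n j m. j \<in> {1..J n} \<Longrightarrow> m \<ge> 1 \<Longrightarrow>
          beta_mixing (\<Omega> n) (T n) (\<lambda>t \<omega>. X n \<omega> j t * u n \<omega> t) m
            \<le> a1 * exp (- a2 * real m powr \<tau>)"
    and sum_squares: "whp \<Omega> (\<lambda>n \<omega>. \<forall>j\<in>{1..J n}.
          (\<Sum>t=1..T n. (X n \<omega> j t)\<^sup>2 * (u n \<omega> t)\<^sup>2) \<le> c3\<^sup>2 * real (T n))"
    and dimension_growth: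
          "(\<lambda>n. ln (real (J n))) \<in> o(\<lambda>n. real (T n) powr (4 * \<tau> / (3 * \<tau> + 4)))"
    and w_in_W: "\<And>n. w n \<in> W n"

end

theory Submission
  imports Defs
begin

text \<open>
  Since \<open>w\<close> competes in the minimisation that defines the estimator \<open>w\<^sub>h\<close>, \<open>\<delta> = w\<^sub>h - w\<close> satisfies
  \<open>\<parallel>X\<delta>\<parallel>\<^sup>2 \<le> 2 u' X \<delta>\<close>, which is at most \<open>4 K max\<^sub>j \<bar>\<Sum>\<^sub>t X\<^bsub>jt\<^esub> u\<^sub>t\<bar>\<close>.
  For \<open>Z\<^sub>t = X\<^bsub>jt\<^esub> u\<^sub>t\<close> the inequality \<open>exp (y - y\<^sup>2) \<le> 1 + y + y\<^sup>2\<close> shows that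
  \<open>V\<^sub>t = exp (\<lambda>Z\<^sub>t - \<lambda>\<^sup>2Z\<^sub>t\<^sup>2 - \<lambda>\<^sup>2s)\<close> has mean at most \<open>1\<close> when \<open>E Z\<^sub>t\<^sup>2 \<le> s\<close>.
  Split \<open>{1..T}\<close> into residue classes modulo \<open>q\<close>. Along a class, \<open>E min (c \<Prod> V\<^sub>t) 1\<close> increases
  by at most the mixing coefficient at lag \<open>q\<close> with every factor: for independent factors it would
  not increase, because the cap is concave, and the cap keeps the test function in \<open>[0, 1]\<close>, where
  \<open>\<beta>\<close> controls the effect of dependence. Markov's inequality bounds the sum over a class, and
  adding up the classes bounds \<open>\<lambda> \<Sum> Z\<^sub>t\<close> by \<open>q L + \<lambda>\<^sup>2 (\<Sum> Z\<^sub>t\<^sup>2 + s T)\<close>, where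
  \<open>\<Sum> Z\<^sub>t\<^sup>2 \<le> c\<^sub>3\<^sup>2 T\<close>. The choices \<open>L \<asymp> ln (max T J)\<close>, \<open>q \<asymp> L\<^bsup>1/\<tau>\<^esup>\<close> and \<open>\<lambda> = sqrt (q L / T)\<close>
  give the rate.
\<close>

subsection \<open>Capped products of weakly dependent factors\<close>

context prob_space
begin

text \<open>Each absolute value is at most the joint mass plus the product mass, and both total one
  over the cells. This keeps the set in \<open>beta_coeff\<close> bounded; the real
  \<open>Sup\<close> of an unbounded set would carry no information.\<close>

lemma sum_abs_dependence_le:
  assumes "finite P" "partition_on (space M) P" "P \<subseteq> events"
    and "finite Q" "partition_on (space M) Q" "Q \<subseteq> events"
  shows "(\<Sum>A\<in>P. \<Sum>B\<in>Q. \<bar>prob (A \<inter> B) - prob A * prob B\<bar>) \<le> 2"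
proof -
  have total: "(\<Sum>A\<in>R. prob (A \<inter> C)) = prob C"
    if "finite R" "partition_on (space M) R" "R \<subseteq> events" "C \<in> events" for R C
  proof -
    have "prob (\<Union>A\<in>R. A \<inter> C) = (\<Sum>A\<in>R. prob (A \<inter> C))"
      using that by (intro finite_measure_finite_Union)
        (force simp: disjoint_family_on_def partition_on_def disjoint_def)+
    moreover have "(\<Union>A\<in>R. A \<inter> C) = C"
      using partition_onD1[OF that(2)] sets.sets_into_space[OF that(4)] by auto
    ultimately show ?thesis by simp
  qed
  have one: "(\<Sum>A\<in>R. prob A) = 1"
    if "finite R" "partition_on (space M) R" "R \<subseteq> events" for R
  proof -
    have "A \<inter> space M = A" if "A \<in> R" for A
      using that \<open>R \<subseteq> events\<close> sets.sets_into_space by blast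
    then show ?thesis using total[OF that sets.top] by (simp add: prob_space)
  qed
  have "(\<Sum>A\<in>P. \<Sum>B\<in>Q. \<bar>prob (A \<inter> B) - prob A * prob B\<bar>)
      \<le> (\<Sum>A\<in>P. \<Sum>B\<in>Q. prob (B \<inter> A) + prob A * prob B)"
    by (intro sum_mono) (simp add: abs_le_iff Int_commute add_increasing add_increasing2)
  also have "\<dots> = 2"
    using assms total[of Q] one[of P] one[of Q]
    by (simp add: sum.distrib subset_iff flip: sum_distrib_left)
  finally show ?thesis .
qed

lemma beta_coeff_bdd_above:
  assumes "\<A> \<subseteq> events" "\<B> \<subseteq> events"
  shows "bdd_above {1 / 2 * (\<Sum>A\<in>P. \<Sum>B\<in>Q. \<bar>prob (A \<inter> B) - prob A * prob B\<bar>) | P Q.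
      finite P \<and> partition_on (space M) P \<and> P \<subseteq> \<A> \<and>
      finite Q \<and> partition_on (space M) Q \<and> Q \<subseteq> \<B>}"
  using assms sum_abs_dependence_le by (intro bdd_aboveI[where M = 1]) fastforce

lemma sum_abs_dependence_le_beta_coeff:
  assumes "\<A> \<subseteq> events" "\<B> \<subseteq> events"
    and "finite P" "partition_on (space M) P" "P \<subseteq> \<A>"
    and "finite Q" "partition_on (space M) Q" "Q \<subseteq> \<B>"
  shows "1 / 2 * (\<Sum>A\<in>P. \<Sum>B\<in>Q. \<bar>prob (A \<inter> B) - prob A * prob B\<bar>) \<le> beta_coeff M \<A> \<B>"
  unfolding beta_coeff_def
  by (rule cSup_upper[OF _ beta_coeff_bdd_above[OF assms(1,2)]]) (use assms in blast)

text \<open>The value type of \<open>U\<close> is arbitrary so that the formula also covers a pair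
  of simple functions, which gives their joint law.\<close>

lemma integral_simple_eq_sum:
  fixes U :: "'a \<Rightarrow> 'b"
  assumes U: "simple_function M U"
  shows "expectation (\<lambda>\<omega>. h (U \<omega>) :: real)
    = (\<Sum>a\<in>U ` space M. h a * prob (U -` {a} \<inter> space M))"
proof -
  have fin: "finite (U ` space M)" using U by (simp add: simple_function_def)
  have ev: "U -` {a} \<inter> space M \<in> events" if "a \<in> U ` space M" for a
    using U that by (auto simp: simple_function_def)
  have "expectation (\<lambda>\<omega>. h (U \<omega>))
      = expectation (\<lambda>\<omega>. \<Sum>a\<in>U ` space M. h a * indicator (U -` {a} \<inter> space M) \<omega>)"
  proof (rule Bochner_Integration.integral_cong[OF refl])
    fix \<omega> assume "\<omega> \<in> space M"
    then have "(\<Sum>a\<in>U ` space M. h a * indicator (U -` {a} \<inter> space M) \<omega>)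
        = (\<Sum>a\<in>U ` space M. if a = U \<omega> then h a else 0)"
      by (intro sum.cong) (auto simp: indicator_def)
    then show "h (U \<omega>) = (\<Sum>a\<in>U ` space M. h a * indicator (U -` {a} \<inter> space M) \<omega>)"
      using fin \<open>\<omega> \<in> space M\<close> by simp
  qed
  also have "\<dots> = (\<Sum>a\<in>U ` space M. h a * prob (U -` {a} \<inter> space M))"
    using ev by (subst Bochner_Integration.integral_sum) (auto simp: emeasure_eq_measure)
  finally show ?thesis .
qed

lemma partition_on_levels:
  "partition_on (space M) ((\<lambda>a. U -` {a} \<inter> space M) ` U ` space M)"
  by (rule partition_onI) (auto simp: disjnt_def)

text \<open>Level sets of attained values are nonempty, hence distinct. Sums over values thus become
  sums over the cells of a partition.\<close>

lemma inj_on_levels: "inj_on (\<lambda>a. U -` {a} \<inter> space M) (U ` space M)"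
  by (rule inj_onI) blast

text \<open>
  The signed dependences sum to zero, so the weights, which lie in \<open>[0, 1]\<close>, may be recentred
  at \<open>1 / 2\<close>; this is where the factor \<open>1 / 2\<close> of \<^const>\<open>beta_coeff\<close> is used.
\<close>

lemma expectation_capped_product_simple:
  fixes U V :: "'a \<Rightarrow> real"
  assumes F: "subalgebra M F" and G: "subalgebra M G"
    and U: "simple_function F U" and V: "simple_function G V"
    and nonneg: "\<And>\<omega>. 0 \<le> U \<omega>" "\<And>\<omega>. 0 \<le> V \<omega>"
    and EV: "expectation V \<le> 1" and c: "0 \<le> c"
  shows "expectation (\<lambda>\<omega>. min (c * (U \<omega> * V \<omega>)) 1)
    \<le> beta_coeff M (sets F) (sets G) + expectation (\<lambda>\<omega>. min (c * U \<omega>) 1)"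
proof -
  let ?A = "\<lambda>a. U -` {a} \<inter> space M" and ?B = "\<lambda>b. V -` {b} \<inter> space M"
  let ?SU = "U ` space M" and ?SV = "V ` space M"
  define d where "d a b = prob (?A a \<inter> ?B b) - prob (?A a) * prob (?B b)" for a b
  define \<phi> where "\<phi> a b = min (c * (a * b)) 1" for a b :: real
  have sub: "sets F \<subseteq> events" "sets G \<subseteq> events" "space F = space M" "space G = space M"
    using F G by (auto simp: subalgebra_def)
  have UM: "simple_function M U" and VM: "simple_function M V"
    using U V sub by (auto simp: simple_function_def)
  have fin: "finite ?SU" "finite ?SV"
    using UM VM by (auto simp: simple_function_def)
  have AF: "?A a \<in> sets F" if "a \<in> ?SU" for a
    using U that sub by (auto simp: simple_function_def)
  have BG: "?B b \<in> sets G" if "b \<in> ?SV" for b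
    using V that sub by (auto simp: simple_function_def)
  \<comment> \<open>The sum runs over the full rectangle of values; pairs that are never attained
    have an empty preimage and add nothing.\<close>
  have joint: "expectation (\<lambda>\<omega>. h (U \<omega>) (V \<omega>))
      = (\<Sum>a\<in>?SU. \<Sum>b\<in>?SV. h a b * prob (?A a \<inter> ?B b))" for h :: "real \<Rightarrow> real \<Rightarrow> real"
  proof -
    let ?W = "\<lambda>\<omega>. (U \<omega>, V \<omega>)"
    have W: "simple_function M ?W" using UM VM by (rule simple_function_Pair)
    have pre: "?W -` {(a, b)} \<inter> space M = ?A a \<inter> ?B b" for a b by auto
    have "expectation (\<lambda>\<omega>. h (U \<omega>) (V \<omega>))
        = (\<Sum>p\<in>?W ` space M. h (fst p) (snd p) * prob (?W -` {p} \<inter> space M))"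
      using integral_simple_eq_sum[OF W, of "\<lambda>p. h (fst p) (snd p)"] by simp
    also have "\<dots> = (\<Sum>p\<in>?SU \<times> ?SV. h (fst p) (snd p) * prob (?W -` {p} \<inter> space M))"
      using fin
    proof (intro sum.mono_neutral_left ballI)
      fix p assume "p \<in> ?SU \<times> ?SV - ?W ` space M"
      then have "?W -` {p} \<inter> space M = {}" by (auto simp: image_iff)
      then show "h (fst p) (snd p) * prob (?W -` {p} \<inter> space M) = 0"
        by (metis measure_empty mult_zero_right)
    qed auto
    also have "\<dots> = (\<Sum>a\<in>?SU. \<Sum>b\<in>?SV. h a b * prob (?W -` {(a, b)} \<inter> space M))"
      by (simp add: sum.cartesian_product case_prod_beta)
    finally show ?thesis unfolding pre .
  qed
  have one: "(\<Sum>a\<in>?SU. prob (?A a)) = 1" "(\<Sum>b\<in>?SV. prob (?B b)) = 1"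
    using integral_simple_eq_sum[OF UM, of "\<lambda>_. 1"] integral_simple_eq_sum[OF VM, of "\<lambda>_. 1"]
    by (simp_all add: prob_space)
  have d0: "(\<Sum>a\<in>?SU. \<Sum>b\<in>?SV. d a b) = 0"
    using joint[of "\<lambda>_ _. 1"] one
    by (simp add: d_def sum_subtractf prob_space flip: sum_distrib_left sum_distrib_right)
  have "(\<Sum>a\<in>?SU. \<Sum>b\<in>?SV. \<phi> a b * d a b)
      = (\<Sum>a\<in>?SU. \<Sum>b\<in>?SV. (\<phi> a b - 1 / 2) * d a b)"
    using d0 by (simp add: left_diff_distrib sum_subtractf flip: sum_divide_distrib)
  also have "\<dots> \<le> (\<Sum>a\<in>?SU. \<Sum>b\<in>?SV. 1 / 2 * \<bar>d a b\<bar>)"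
  proof (intro sum_mono)
    fix a b assume "a \<in> ?SU" "b \<in> ?SV"
    then have "0 \<le> \<phi> a b" "\<phi> a b \<le> 1"
      using nonneg c by (auto simp: \<phi>_def)
    then have "\<bar>\<phi> a b - 1 / 2\<bar> \<le> 1 / 2" by linarith
    then have "\<bar>\<phi> a b - 1 / 2\<bar> * \<bar>d a b\<bar> \<le> 1 / 2 * \<bar>d a b\<bar>"
      by (intro mult_right_mono) auto
    then show "(\<phi> a b - 1 / 2) * d a b \<le> 1 / 2 * \<bar>d a b\<bar>"
      by (metis abs_le_D1 abs_mult)
  qed
  also have "\<dots> = 1 / 2 * (\<Sum>A\<in>?A ` ?SU. \<Sum>B\<in>?B ` ?SV. \<bar>prob (A \<inter> B) - prob A * prob B\<bar>)"
    by (simp add: sum.reindex[OF inj_on_levels] d_def flip: sum_divide_distrib)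
  also have "\<dots> \<le> beta_coeff M (sets F) (sets G)"
    using fin AF BG
    by (intro sum_abs_dependence_le_beta_coeff[OF sub(1,2)] partition_on_levels) auto
  finally have dep: "(\<Sum>a\<in>?SU. \<Sum>b\<in>?SV. \<phi> a b * d a b) \<le> beta_coeff M (sets F) (sets G)" .
  \<comment> \<open>Under the product law \<open>b\<close> is summed out first. The capped function
    lies below \<open>c * a * b\<close>, whose mean is at most \<open>c * a\<close> by
    \<open>EV\<close>, and below one: Jensen's inequality for the concave cap.\<close>
  have "(\<Sum>b\<in>?SV. \<phi> a b * prob (?B b)) \<le> min (c * a) 1" if "a \<in> ?SU" for a
  proof -
    have "0 \<le> c * a" using that nonneg c by auto
    have "(\<Sum>b\<in>?SV. \<phi> a b * prob (?B b)) \<le> (\<Sum>b\<in>?SV. c * a * (b * prob (?B b)))"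
    proof (intro sum_mono)
      fix b show "\<phi> a b * prob (?B b) \<le> c * a * (b * prob (?B b))"
        using mult_right_mono[of "\<phi> a b" "c * (a * b)" "prob (?B b)"] by (simp add: \<phi>_def mult_ac)
    qed
    also have "\<dots> = c * a * expectation V"
      using integral_simple_eq_sum[OF VM, of "\<lambda>b. b"] by (simp add: sum_distrib_left)
    also have "\<dots> \<le> c * a" using mult_left_mono[OF EV \<open>0 \<le> c * a\<close>] by simp
    finally have 1: "(\<Sum>b\<in>?SV. \<phi> a b * prob (?B b)) \<le> c * a" .
    have "(\<Sum>b\<in>?SV. \<phi> a b * prob (?B b)) \<le> (\<Sum>b\<in>?SV. 1 * prob (?B b))"
      by (intro sum_mono mult_right_mono) (auto simp: \<phi>_def)
    with 1 one show ?thesis by simp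
  qed
  then have "(\<Sum>a\<in>?SU. (\<Sum>b\<in>?SV. \<phi> a b * prob (?B b)) * prob (?A a))
      \<le> (\<Sum>a\<in>?SU. min (c * a) 1 * prob (?A a))"
    by (intro sum_mono mult_right_mono) auto
  also have "\<dots> = expectation (\<lambda>\<omega>. min (c * U \<omega>) 1)"
    using integral_simple_eq_sum[OF UM, of "\<lambda>a. min (c * a) 1"] by simp
  finally have indep: "(\<Sum>a\<in>?SU. \<Sum>b\<in>?SV. \<phi> a b * (prob (?A a) * prob (?B b)))
      \<le> expectation (\<lambda>\<omega>. min (c * U \<omega>) 1)"
    unfolding sum_distrib_right by (simp add: mult_ac)
  have "expectation (\<lambda>\<omega>. \<phi> (U \<omega>) (V \<omega>)) = (\<Sum>a\<in>?SU. \<Sum>b\<in>?SV. \<phi> a b * d a b)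
      + (\<Sum>a\<in>?SU. \<Sum>b\<in>?SV. \<phi> a b * (prob (?A a) * prob (?B b)))"
    by (simp add: joint d_def flip: sum.distrib) (simp add: algebra_simps)
  with dep indep show ?thesis by (simp add: \<phi>_def)
qed

text \<open>Simple functions increase to \<open>U\<close> and to \<open>V\<close>, each measurable
  for its own subalgebra. Approximating from below keeps the mean of the second factor at most one,
  and the cap supplies the dominating constant for the limit.\<close>

lemma expectation_capped_product:
  fixes U V :: "'a \<Rightarrow> real"
  assumes F: "subalgebra M F" and G: "subalgebra M G"
    and U: "U \<in> borel_measurable F" and V: "V \<in> borel_measurable G"
    and nonneg: "\<And>\<omega>. 0 \<le> U \<omega>" "\<And>\<omega>. 0 \<le> V \<omega>"
    and iV: "integrable M V" and EV: "expectation V \<le> 1" and c: "0 \<le> c"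
  shows "expectation (\<lambda>\<omega>. min (c * (U \<omega> * V \<omega>)) 1)
    \<le> beta_coeff M (sets F) (sets G) + expectation (\<lambda>\<omega>. min (c * U \<omega>) 1)"
proof -
  have approx: "\<exists>f. (\<forall>i. simple_function N (f i)) \<and> (\<forall>i x. 0 \<le> f i x \<and> f i x \<le> h x) \<and>
      (\<forall>x. (\<lambda>i. f i x) \<longlonglongrightarrow> h x)"
    if h: "h \<in> borel_measurable N" "\<And>x. 0 \<le> h x" for h :: "'a \<Rightarrow> real" and N
  proof -
    obtain f where f: "incseq f" "\<And>i. simple_function N (f i)" "\<And>i x. 0 \<le> f i x"
        "\<And>x. bdd_above (range (\<lambda>i. f i x))" "h = (SUP i. f i)"
      using borel_measurable_implies_simple_function_sequence_real[OF h] by blast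
    have hx: "h x = (SUP i. f i x)" for x by (simp add: f(5) image_comp)
    have "f i x \<le> h x" for i x
      unfolding hx by (rule cSUP_upper) (use f in auto)
    moreover have "(\<lambda>i. f i x) \<longlonglongrightarrow> h x" for x
      unfolding hx using f by (intro LIMSEQ_incseq_SUP) (auto simp: incseq_def le_fun_def)
    ultimately show ?thesis using f by blast
  qed
  obtain Ui where Ui: "\<And>i. simple_function F (Ui i)" "\<And>i x. 0 \<le> Ui i x"
      "\<And>i x. Ui i x \<le> U x" "\<And>x. (\<lambda>i. Ui i x) \<longlonglongrightarrow> U x"
    using approx[OF U nonneg(1)] by metis
  obtain Vi where Vi: "\<And>i. simple_function G (Vi i)" "\<And>i x. 0 \<le> Vi i x"
      "\<And>i x. Vi i x \<le> V x" "\<And>x. (\<lambda>i. Vi i x) \<longlonglongrightarrow> V x"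
    using approx[OF V nonneg(2)] by metis
  have meas: "f \<in> borel_measurable M" if "f \<in> borel_measurable F \<or> f \<in> borel_measurable G"
    for f :: "'a \<Rightarrow> real"
    using that F G measurable_from_subalg by blast
  have [measurable]: "U \<in> borel_measurable M" "V \<in> borel_measurable M"
    "Ui i \<in> borel_measurable M" "Vi i \<in> borel_measurable M" for i
    using U V Ui(1) Vi(1) by (meson meas borel_measurable_simple_function)+
  have "expectation (\<lambda>\<omega>. min (c * (Ui i \<omega> * Vi i \<omega>)) 1)
      \<le> beta_coeff M (sets F) (sets G) + expectation (\<lambda>\<omega>. min (c * U \<omega>) 1)" for i
  proof -
    have "expectation (Vi i) \<le> expectation V"
      by (rule integral_mono') (auto simp: iV Vi nonneg)
    then have "expectation (\<lambda>\<omega>. min (c * (Ui i \<omega> * Vi i \<omega>)) 1)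
      \<le> beta_coeff M (sets F) (sets G) + expectation (\<lambda>\<omega>. min (c * Ui i \<omega>) 1)"
      using EV by (intro expectation_capped_product_simple F G Ui Vi c) auto
    also have "expectation (\<lambda>\<omega>. min (c * Ui i \<omega>) 1) \<le> expectation (\<lambda>\<omega>. min (c * U \<omega>) 1)"
    proof (rule integral_mono')
      show "integrable M (\<lambda>\<omega>. min (c * U \<omega>) 1)"
        by (rule integrable_const_bound[where B = 1]) (auto simp: nonneg c abs_le_iff min_le_iff_disj add_increasing)
      show "min (c * Ui i \<omega>) 1 \<le> min (c * U \<omega>) 1" for \<omega>
        using mult_left_mono[OF Ui(3) c] by (rule min.mono) auto
    qed (auto simp: nonneg c)
    finally show ?thesis by simp
  qed
  moreover have "(\<lambda>i. expectation (\<lambda>\<omega>. min (c * (Ui i \<omega> * Vi i \<omega>)) 1))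
      \<longlonglongrightarrow> expectation (\<lambda>\<omega>. min (c * (U \<omega> * V \<omega>)) 1)"
    by (rule integral_dominated_convergence[where w = "\<lambda>_. 1"])
      (auto intro!: tendsto_intros Ui Vi simp: Ui Vi c abs_le_iff min_le_iff_disj add_increasing)
  ultimately show ?thesis by (intro LIMSEQ_le_const2) auto
qed

end

section \<open>Blocks of indices and induction along separated indices\<close>

text \<open>\<open>generated_events\<close> is only a family of sets; measurability and
  \<open>subalgebra\<close> require a measure object with that family as its measurable
  sets.\<close>

definition generated_algebra :: "'a measure \<Rightarrow> (nat \<Rightarrow> 'a \<Rightarrow> real) \<Rightarrow> nat set \<Rightarrow> 'a measure" where
  "generated_algebra N Z I =
    sigma (space N) {Z i -` S \<inter> space N | i S. i \<in> I \<and> S \<in> sets borel}"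

lemma space_generated_algebra [simp]: "space (generated_algebra N Z I) = space N"
  by (auto simp: generated_algebra_def intro!: space_measure_of)

lemma sets_generated_algebra: "sets (generated_algebra N Z I) = generated_events N Z I"
  unfolding generated_algebra_def generated_events_def by (rule sets_measure_of) auto

lemma subalgebra_generated_algebra:
  assumes "\<And>i. i \<in> I \<Longrightarrow> Z i \<in> borel_measurable N"
  shows "subalgebra N (generated_algebra N Z I)"
  unfolding subalgebra_def sets_generated_algebra generated_events_def
  using assms by (auto intro!: sets.sigma_sets_subset measurable_sets)

lemma measurable_generated_algebra:
  "i \<in> I \<Longrightarrow> Z i \<in> borel_measurable (generated_algebra N Z I)"
  by (rule measurableI) (auto simp: sets_generated_algebra generated_events_def)

context prob_space
begin

lemma beta_coeff_le_beta_mixing: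
  assumes "k \<le> T"
  shows "beta_coeff M (generated_events M Z {1..k}) (generated_events M Z {k+m..T})
    \<le> beta_mixing M T Z m"
  unfolding beta_mixing_def using assms by (intro cSUP_upper) auto

text \<open>Induction that peels off the largest index. Each later factor costs one mixing
  coefficient, at most \<open>B\<close>, while the capped expectation starts from at most
  \<open>c\<close>.\<close>

lemma expectation_capped_prod_le:
  fixes Z :: "nat \<Rightarrow> 'a \<Rightarrow> real" and g :: "real \<Rightarrow> real"
  assumes "finite D" "D \<subseteq> {1..T}"
    and gap: "\<And>s t. s \<in> D \<Longrightarrow> t \<in> D \<Longrightarrow> s < t \<Longrightarrow> s + q \<le> t"
    and Z: "\<And>t. t \<in> {1..T} \<Longrightarrow> Z t \<in> borel_measurable M"
    and g: "g \<in> borel_measurable borel" "\<And>x. 0 \<le> g x"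
    and ig: "\<And>t. t \<in> {1..T} \<Longrightarrow> integrable M (\<lambda>\<omega>. g (Z t \<omega>))"
    and Eg: "\<And>t. t \<in> {1..T} \<Longrightarrow> expectation (\<lambda>\<omega>. g (Z t \<omega>)) \<le> 1"
    and B: "beta_mixing M T Z q \<le> B" "0 \<le> B" and c: "0 \<le> c"
  shows "expectation (\<lambda>\<omega>. min (c * (\<Prod>t\<in>D. g (Z t \<omega>))) 1) \<le> c + real (card D) * B"
  using assms(1-3)
proof (induction D rule: finite_linorder_max_induct)
  case empty
  then show ?case by (simp add: prob_space)
next
  case (insert b D)
  have b: "b \<in> {1..T}" using insert.prems by auto
  show ?case
  proof (cases "D = {}")
    case True
    have "expectation (\<lambda>\<omega>. min (c * g (Z b \<omega>)) 1) \<le> expectation (\<lambda>\<omega>. c * g (Z b \<omega>))"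
      using ig[OF b] c g by (intro integral_mono') auto
    also have "\<dots> \<le> c" using mult_left_mono[OF Eg[OF b] c] by simp
    finally show ?thesis using True B by simp
  next
    case False
    \<comment> \<open>The past is cut at the last earlier index. By \<open>gap\<close> the new index
      lies in \<open>{k+q..T}\<close>, so the two blocks are the ones compared by
      \<open>beta_mixing\<close> at lag \<open>q\<close>.\<close>
    define k where "k = Max D"
    have k: "k \<in> D" "\<And>t. t \<in> D \<Longrightarrow> t \<le> k" using False insert.hyps by (auto simp: k_def)
    have "k + q \<le> b" using insert k by auto
    let ?F = "generated_algebra M Z {1..k}" and ?G = "generated_algebra M Z {k+q..T}"
    have "k \<le> T" using k insert.prems by auto
    have "k \<ge> 1" using k insert.prems by auto
    have Zb [measurable]: "Z b \<in> borel_measurable ?G"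
      using b \<open>k + q \<le> b\<close> by (intro measurable_generated_algebra) auto
    have ZD: "Z t \<in> borel_measurable ?F" if "t \<in> D" for t
      using k that insert.prems by (intro measurable_generated_algebra) auto
    note g(1) [measurable]
    have "expectation (\<lambda>\<omega>. min (c * ((\<Prod>t\<in>D. g (Z t \<omega>)) * g (Z b \<omega>))) 1)
        \<le> beta_coeff M (sets ?F) (sets ?G) + expectation (\<lambda>\<omega>. min (c * (\<Prod>t\<in>D. g (Z t \<omega>))) 1)"
    proof (rule expectation_capped_product)
      show "subalgebra M ?F" "subalgebra M ?G"
        using Z \<open>k \<le> T\<close> \<open>k \<ge> 1\<close> by (auto intro!: subalgebra_generated_algebra)
      show "(\<lambda>\<omega>. \<Prod>t\<in>D. g (Z t \<omega>)) \<in> borel_measurable ?F"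
        using ZD by (intro borel_measurable_prod measurable_compose[OF _ g(1)])
      show "0 \<le> (\<Prod>t\<in>D. g (Z t \<omega>))" for \<omega> by (intro prod_nonneg) (simp add: g)
    qed (use g c ig[OF b] Eg[OF b] in auto)
    also have "beta_coeff M (sets ?F) (sets ?G) \<le> B"
      using beta_coeff_le_beta_mixing[OF \<open>k \<le> T\<close>, of Z q] B by (simp add: sets_generated_algebra)
    also have "expectation (\<lambda>\<omega>. min (c * (\<Prod>t\<in>D. g (Z t \<omega>))) 1) \<le> c + real (card D) * B"
      using insert by auto
    moreover have "b \<notin> D" using insert.hyps by auto
    ultimately show ?thesis using insert.hyps by (simp add: algebra_simps)
  qed
qed

end

subsection \<open>Self-normalized sums\<close>

text \<open>The reciprocal of the left side is at least \<open>1 - y + y\<^sup>2\<close>, and its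
  product with the right side is \<open>1 + y\<^sup>2 + y\<^sup>4\<close>, which is at least
  one.\<close>

lemma exp_diff_square_le:
  fixes y :: real
  shows "exp (y - y\<^sup>2) \<le> 1 + y + y\<^sup>2"
proof -
  have pos: "0 < 1 + y + y\<^sup>2"
    using zero_le_power2[of "y + 1 / 2"] by (simp add: power2_eq_square algebra_simps)
  have "1 \<le> (1 + y + y\<^sup>2) * (1 - y + y\<^sup>2)"
  proof -
    have "(1 + y + y\<^sup>2) * (1 - y + y\<^sup>2) = 1 + y\<^sup>2 + (y\<^sup>2)\<^sup>2" by algebra
    then show ?thesis by simp
  qed
  also have "\<dots> \<le> (1 + y + y\<^sup>2) * exp (y\<^sup>2 - y)"
    using exp_ge_add_one_self[of "y\<^sup>2 - y"] pos by (intro mult_left_mono) (auto simp: algebra_simps)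
  finally have "exp (y - y\<^sup>2) * 1 \<le> exp (y - y\<^sup>2) * ((1 + y + y\<^sup>2) * exp (y\<^sup>2 - y))"
    by (intro mult_left_mono) auto
  also have "\<dots> = 1 + y + y\<^sup>2"
    by (simp add: mult.left_commute flip: exp_add)
  finally show ?thesis by simp
qed

context prob_space
begin

text \<open>
  The compensator \<open>y\<^sup>2\<close> in the exponent makes the exponential moment finite without any moment
  of order above two.
\<close>

lemma expectation_self_normalized_exp:
  fixes Z :: "'a \<Rightarrow> real" and l s :: real
  assumes Z: "integrable M Z" "expectation Z = 0"
    and Z2: "integrable M (\<lambda>\<omega>. (Z \<omega>)\<^sup>2)" "expectation (\<lambda>\<omega>. (Z \<omega>)\<^sup>2) \<le> s"
  shows "integrable M (\<lambda>\<omega>. exp (l * Z \<omega> - l\<^sup>2 * (Z \<omega>)\<^sup>2 - l\<^sup>2 * s))"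
    and "expectation (\<lambda>\<omega>. exp (l * Z \<omega> - l\<^sup>2 * (Z \<omega>)\<^sup>2 - l\<^sup>2 * s)) \<le> 1"
proof -
  \<comment> \<open>The zero mean removes the linear term of \<open>?h\<close>; the remaining factor
    \<open>1 + l\<^sup>2 * s\<close> is at most \<open>exp (l\<^sup>2 * s)\<close> and cancels
    against the last factor.\<close>
  let ?h = "\<lambda>\<omega>. (1 + l * Z \<omega> + l\<^sup>2 * (Z \<omega>)\<^sup>2) * exp (- (l\<^sup>2 * s))"
  have le: "exp (l * Z \<omega> - l\<^sup>2 * (Z \<omega>)\<^sup>2 - l\<^sup>2 * s) \<le> ?h \<omega>" for \<omega>
    using exp_diff_square_le[of "l * Z \<omega>"]
    by (simp add: power_mult_distrib exp_diff exp_minus divide_inverse)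
  have ih: "integrable M ?h" using Z Z2 by (intro integrable_mult_left) auto
  show i: "integrable M (\<lambda>\<omega>. exp (l * Z \<omega> - l\<^sup>2 * (Z \<omega>)\<^sup>2 - l\<^sup>2 * s))"
    using Z(1) by (intro Bochner_Integration.integrable_bound[OF ih]) (auto intro!: AE_I2 order_trans[OF le abs_ge_self])
  have "expectation (\<lambda>\<omega>. exp (l * Z \<omega> - l\<^sup>2 * (Z \<omega>)\<^sup>2 - l\<^sup>2 * s)) \<le> expectation ?h"
    by (rule integral_mono[OF i ih le])
  also have "\<dots> = (1 + l\<^sup>2 * expectation (\<lambda>\<omega>. (Z \<omega>)\<^sup>2)) * exp (- (l\<^sup>2 * s))"
    using Z Z2 by (simp add: prob_space)
  also have "\<dots> \<le> (1 + l\<^sup>2 * s) * exp (- (l\<^sup>2 * s))"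
    using Z2 by (intro mult_right_mono add_left_mono mult_left_mono) auto
  also have "\<dots> \<le> exp (l\<^sup>2 * s) * exp (- (l\<^sup>2 * s))"
    by (intro mult_right_mono exp_ge_add_one_self) auto
  finally show "expectation (\<lambda>\<omega>. exp (l * Z \<omega> - l\<^sup>2 * (Z \<omega>)\<^sup>2 - l\<^sup>2 * s)) \<le> 1"
    by (simp flip: exp_add)
qed

text \<open>A Chernoff bound with a capped exponential: where the sum exceeds \<open>L\<close> the
  capped variable equals one, so Markov's inequality at level one reduces the claim to the product
  bound with \<open>c = exp (- L)\<close>.\<close>

lemma prob_separated_sum_gt:
  fixes Z :: "nat \<Rightarrow> 'a \<Rightarrow> real" and l s L :: real
  assumes D: "D \<subseteq> {1..T}"
    and gap: "\<And>s t. s \<in> D \<Longrightarrow> t \<in> D \<Longrightarrow> s < t \<Longrightarrow> s + q \<le> t"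
    and Z: "\<And>t. t \<in> {1..T} \<Longrightarrow> integrable M (Z t) \<and> expectation (Z t) = 0"
    and Z2: "\<And>t. t \<in> {1..T} \<Longrightarrow>
      integrable M (\<lambda>\<omega>. (Z t \<omega>)\<^sup>2) \<and> expectation (\<lambda>\<omega>. (Z t \<omega>)\<^sup>2) \<le> s"
    and B: "beta_mixing M T Z q \<le> B" "0 \<le> B"
  shows "prob {\<omega> \<in> space M. L < (\<Sum>t\<in>D. l * Z t \<omega> - l\<^sup>2 * (Z t \<omega>)\<^sup>2 - l\<^sup>2 * s)}
    \<le> exp (- L) + real (card D) * B"
proof -
  define g where "g x = exp (l * x - l\<^sup>2 * x\<^sup>2 - l\<^sup>2 * s)" for x
  let ?S = "\<lambda>\<omega>. \<Sum>t\<in>D. l * Z t \<omega> - l\<^sup>2 * (Z t \<omega>)\<^sup>2 - l\<^sup>2 * s"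
  let ?\<phi> = "\<lambda>\<omega>. min (exp (- L) * (\<Prod>t\<in>D. g (Z t \<omega>))) 1"
  have fin: "finite D" using D finite_subset by blast
  have Zm: "Z t \<in> borel_measurable M" if "t \<in> {1..T}" for t using Z[OF that] by auto
  then have ZD [measurable]: "Z t \<in> borel_measurable M" if "t \<in> D" for t using D that by auto
  have gm [measurable]: "g \<in> borel_measurable borel" unfolding g_def by measurable
  have eq: "exp (- L) * (\<Prod>t\<in>D. g (Z t \<omega>)) = exp (?S \<omega> - L)" for \<omega>
    by (simp add: g_def exp_sum[OF fin] exp_diff exp_minus divide_inverse)
  have i: "integrable M ?\<phi>"
  proof (rule integrable_const_bound[where B = 1])
    show "?\<phi> \<in> borel_measurable M" by measurable
  qed (simp add: eq)
  have "prob {\<omega> \<in> space M. L < ?S \<omega>} \<le> prob {\<omega> \<in> space M. 1 \<le> ?\<phi> \<omega>}"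
    using i by (intro finite_measure_mono) (auto simp: eq)
  also have "\<dots> \<le> expectation ?\<phi> / 1"
    using i by (intro integral_Markov_inequality_measure[where A = "{}"]) (auto simp: eq)
  also have "\<dots> \<le> exp (- L) + real (card D) * B"
    using expectation_self_normalized_exp Z Z2
    by (simp, intro expectation_capped_prod_le[OF fin D gap Zm gm _ _ _ B])
      (auto simp: g_def)
  finally show ?thesis .
qed

end

section \<open>Tail bound for the largest score\<close>

text \<open>In the first factor, \<open>v\<close> and \<open>s\<close> pay for the two compensators
  and \<open>1\<close> for the threshold. Under the root, \<open>3\<close> comes from the level
  \<open>3 * ln A\<close> and the bracket bounds the number of classes in units of
  \<open>ln A powr (1 / \<tau>)\<close>.\<close>

definition score_constant :: "real \<Rightarrow> real \<Rightarrow> real \<Rightarrow> real \<Rightarrow> real" where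
  "score_constant a2 \<tau> s v = (v + s + 1) * sqrt (3 * ((4 / a2) powr (1 / \<tau>) + 1))"

context prob_space
begin

text \<open>If the total exceeds \<open>q * L\<close>, then one of the at most \<open>q\<close>
  residue classes has a sum above \<open>L\<close>; within a class distinct indices are at least
  \<open>q\<close> apart.\<close>

lemma prob_sum_gt:
  fixes Z :: "nat \<Rightarrow> 'a \<Rightarrow> real" and l s L :: real
  assumes Z: "\<And>t. t \<in> {1..T} \<Longrightarrow> integrable M (Z t) \<and> expectation (Z t) = 0"
    and Z2: "\<And>t. t \<in> {1..T} \<Longrightarrow>
      integrable M (\<lambda>\<omega>. (Z t \<omega>)\<^sup>2) \<and> expectation (\<lambda>\<omega>. (Z t \<omega>)\<^sup>2) \<le> s"
    and B: "beta_mixing M T Z q \<le> B" "0 \<le> B" and q: "1 \<le> q" and L: "0 \<le> L"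
  shows "prob {\<omega> \<in> space M. real q * L < (\<Sum>t=1..T. l * Z t \<omega> - l\<^sup>2 * (Z t \<omega>)\<^sup>2 - l\<^sup>2 * s)}
    \<le> real T * (exp (- L) + real T * B)"
proof -
  \<comment> \<open>Only residues that occur are kept, which gives two bounds on their number:
    \<open>q\<close> for the threshold and \<open>T\<close> for the union bound.\<close>
  define R where "R = (\<lambda>t. t mod q) ` {1..T}"
  define D where "D r = {t \<in> {1..T}. t mod q = r}" for r
  define f where "f t \<omega> = l * Z t \<omega> - l\<^sup>2 * (Z t \<omega>)\<^sup>2 - l\<^sup>2 * s" for t \<omega>
  have f [measurable]: "f t \<in> borel_measurable M" if "t \<in> {1..T}" for t
  proof -
    have [measurable]: "Z t \<in> borel_measurable M" using Z[OF that] by auto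
    show ?thesis unfolding f_def by measurable
  qed
  have sum_split: "(\<Sum>t=1..T. f t \<omega>) = (\<Sum>r\<in>R. \<Sum>t\<in>D r. f t \<omega>)" for \<omega>
    unfolding R_def D_def by (rule sum.image_gen) simp
  have R: "finite R" "card R \<le> T" "R \<subseteq> {..<q}"
    using q card_image_le[of "{1..T}" "\<lambda>t. t mod q"] by (auto simp: R_def)
  have "card R \<le> q" using card_mono[OF _ R(3)] by simp
  have Dm [measurable]: "(\<lambda>\<omega>. \<Sum>t\<in>D r. f t \<omega>) \<in> borel_measurable M" for r
    by (intro borel_measurable_sum f) (simp add: D_def)
  have gap: "a + q \<le> b" if "a \<in> D r" "b \<in> D r" "a < b" for a b r
  proof -
    have "q dvd b - a" using that mod_eq_dvd_iff_nat[of a b q] by (simp add: D_def)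
    then show ?thesis using \<open>a < b\<close> dvd_imp_le[of q "b - a"] by simp
  qed
  have "prob {\<omega> \<in> space M. real q * L < (\<Sum>t=1..T. f t \<omega>)}
      \<le> prob (\<Union>r\<in>R. {\<omega> \<in> space M. L < (\<Sum>t\<in>D r. f t \<omega>)})"
  proof (intro finite_measure_mono subsetI)
    fix \<omega> assume \<omega>: "\<omega> \<in> {\<omega> \<in> space M. real q * L < (\<Sum>t=1..T. f t \<omega>)}"
    show "\<omega> \<in> (\<Union>r\<in>R. {\<omega> \<in> space M. L < (\<Sum>t\<in>D r. f t \<omega>)})"
    proof (rule ccontr)
      assume "\<omega> \<notin> (\<Union>r\<in>R. {\<omega> \<in> space M. L < (\<Sum>t\<in>D r. f t \<omega>)})"
      then have "(\<Sum>r\<in>R. \<Sum>t\<in>D r. f t \<omega>) \<le> (\<Sum>r\<in>R. L)"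
        using \<omega> by (intro sum_mono) (auto simp: not_less)
      also have "\<dots> \<le> real q * L"
        using \<open>card R \<le> q\<close> L by (simp add: mult_right_mono)
      finally show False using \<omega> unfolding sum_split by simp
    qed
  qed (use R in measurable)
  also have "\<dots> \<le> (\<Sum>r\<in>R. prob {\<omega> \<in> space M. L < (\<Sum>t\<in>D r. f t \<omega>)})"
    using R by (intro finite_measure_subadditive_finite) auto
  also have "\<dots> \<le> (\<Sum>r\<in>R. exp (- L) + real T * B)"
  proof (rule sum_mono)
    fix r
    have "prob {\<omega> \<in> space M. L < (\<Sum>t\<in>D r. f t \<omega>)} \<le> exp (- L) + real (card (D r)) * B"
      unfolding f_def by (rule prob_separated_sum_gt[OF _ gap Z Z2 B]) (auto simp: D_def)
    also have "D r \<subseteq> {1..T}" by (auto simp: D_def)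
    then have "card (D r) \<le> T"
      using card_mono[of "{1..T}" "D r"] by simp
    then have "exp (- L) + real (card (D r)) * B \<le> exp (- L) + real T * B"
      using B by (simp add: mult_right_mono)
    finally show "prob {\<omega> \<in> space M. L < (\<Sum>t\<in>D r. f t \<omega>)} \<le> exp (- L) + real T * B" .
  qed
  also have "\<dots> \<le> real T * (exp (- L) + real T * B)"
    using R B by (simp add: mult_right_mono)
  finally show ?thesis by (simp add: f_def)
qed

text \<open>The two tails are the events for \<open>l\<close> and \<open>- l\<close>. When the
  squares sum to at most \<open>v * T\<close>, the compensators use at most
  \<open>(v + s) * q * L\<close>, so an excess over \<open>(v + s + 1) * q * L\<close> leaves more
  than \<open>q * L\<close>.\<close>

lemma prob_abs_sum_gt:
  fixes Z :: "nat \<Rightarrow> 'a \<Rightarrow> real" and s v L :: real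
  assumes Z: "\<And>t. t \<in> {1..T} \<Longrightarrow> integrable M (Z t) \<and> expectation (Z t) = 0"
    and Z2: "\<And>t. t \<in> {1..T} \<Longrightarrow>
      integrable M (\<lambda>\<omega>. (Z t \<omega>)\<^sup>2) \<and> expectation (\<lambda>\<omega>. (Z t \<omega>)\<^sup>2) \<le> s"
    and B: "beta_mixing M T Z q \<le> B" "0 \<le> B" and q: "1 \<le> q" and L: "0 < L" and T: "1 \<le> T"
  shows "prob {\<omega> \<in> space M. (\<Sum>t=1..T. (Z t \<omega>)\<^sup>2) \<le> v * real T \<and>
      (v + s + 1) * sqrt (real q * L * real T) < \<bar>\<Sum>t=1..T. Z t \<omega>\<bar>}
    \<le> 2 * real T * (exp (- L) + real T * B)"
proof -
  \<comment> \<open>This choice gives \<open>l\<^sup>2 * T = q * L\<close>, so the threshold and the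
    bounds on both compensators are multiples of the same quantity.\<close>
  define l where "l = sqrt (real q * L / real T)"
  define E where "E l = {\<omega> \<in> space M. real q * L
    < (\<Sum>t=1..T. l * Z t \<omega> - l\<^sup>2 * (Z t \<omega>)\<^sup>2 - l\<^sup>2 * s)}" for l
  have l: "0 < l" "l\<^sup>2 * real T = real q * L"
    using q L T by (simp_all add: l_def)
  have "l * sqrt (real q * L * real T) = sqrt ((real q * L)\<^sup>2)"
  proof -
    have "real q * L / real T * (real q * L * real T) = (real q * L)\<^sup>2"
      using T by (simp add: power2_eq_square)
    then show ?thesis by (simp only: l_def flip: real_sqrt_mult)
  qed
  then have l_sqrt: "l * sqrt (real q * L * real T) = real q * L"
    using L by simp
  have Zm [measurable]: "Z t \<in> borel_measurable M" if "t \<in> {1..T}" for t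
    using Z[OF that] by auto
  have Em [measurable]: "E l \<in> events" for l unfolding E_def by measurable
  have "prob {\<omega> \<in> space M. (\<Sum>t=1..T. (Z t \<omega>)\<^sup>2) \<le> v * real T \<and>
      (v + s + 1) * sqrt (real q * L * real T) < \<bar>\<Sum>t=1..T. Z t \<omega>\<bar>} \<le> prob (E l \<union> E (- l))"
  proof (intro finite_measure_mono subsetI)
    fix \<omega> assume "\<omega> \<in> {\<omega> \<in> space M. (\<Sum>t=1..T. (Z t \<omega>)\<^sup>2) \<le> v * real T \<and>
      (v + s + 1) * sqrt (real q * L * real T) < \<bar>\<Sum>t=1..T. Z t \<omega>\<bar>}"
    then have \<omega>: "\<omega> \<in> space M" and sq: "(\<Sum>t=1..T. (Z t \<omega>)\<^sup>2) \<le> v * real T"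
      and gt: "(v + s + 1) * sqrt (real q * L * real T) < \<bar>\<Sum>t=1..T. Z t \<omega>\<bar>" by auto
    have "l * ((v + s + 1) * sqrt (real q * L * real T)) < l * \<bar>\<Sum>t=1..T. Z t \<omega>\<bar>"
      using gt l(1) by (rule mult_strict_left_mono)
    moreover have "l * ((v + s + 1) * sqrt (real q * L * real T)) = (v + s + 1) * (real q * L)"
      by (subst l_sqrt[symmetric]) (simp add: mult_ac)
    ultimately have 1: "(v + s + 1) * (real q * L) < l * \<bar>\<Sum>t=1..T. Z t \<omega>\<bar>" by simp
    have "l\<^sup>2 * (\<Sum>t=1..T. (Z t \<omega>)\<^sup>2) \<le> l\<^sup>2 * (v * real T)"
      by (rule mult_left_mono[OF sq]) simp
    also have "\<dots> = v * (real q * L)" by (simp flip: l(2))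
    finally have 2: "l\<^sup>2 * (\<Sum>t=1..T. (Z t \<omega>)\<^sup>2) \<le> v * (real q * L)" .
    have 3: "(\<Sum>t=1..T. k * Z t \<omega> - k\<^sup>2 * (Z t \<omega>)\<^sup>2 - k\<^sup>2 * s)
        = k * (\<Sum>t=1..T. Z t \<omega>) - k\<^sup>2 * (\<Sum>t=1..T. (Z t \<omega>)\<^sup>2) - s * (k\<^sup>2 * real T)" for k
      by (simp add: sum_subtractf sum_distrib_left)
    show "\<omega> \<in> E l \<union> E (- l)"
    proof (cases "0 \<le> (\<Sum>t=1..T. Z t \<omega>)")
      case True
      then have "real q * L < l * (\<Sum>t=1..T. Z t \<omega>)
          - l\<^sup>2 * (\<Sum>t=1..T. (Z t \<omega>)\<^sup>2) - s * (l\<^sup>2 * real T)"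
        using 1 2 unfolding l(2) by (simp add: algebra_simps)
      then have "\<omega> \<in> E l" using \<omega> unfolding E_def mem_Collect_eq 3 by simp
      then show ?thesis by simp
    next
      case False
      then have "real q * L < - l * (\<Sum>t=1..T. Z t \<omega>)
          - l\<^sup>2 * (\<Sum>t=1..T. (Z t \<omega>)\<^sup>2) - s * (l\<^sup>2 * real T)"
        using 1 2 unfolding l(2) by (simp add: algebra_simps)
      then have "\<omega> \<in> E (- l)" using \<omega> unfolding E_def mem_Collect_eq 3 by simp
      then show ?thesis by simp
    qed
  qed measurable
  also have "\<dots> \<le> prob (E l) + prob (E (- l))"
    by (intro measure_Un_le) auto
  also have "\<dots> \<le> real T * (exp (- L) + real T * B) + real T * (exp (- L) + real T * B)"
    unfolding E_def using L by (intro add_mono prob_sum_gt[OF Z Z2 B q]) auto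
  finally show ?thesis by simp
qed

text \<open>
  With residue classes modulo \<open>q \<approx> (4 ln A / a\<^sub>2)\<^bsup>1/\<tau>\<^esup>\<close>, \<open>A = max T J\<close>, both the exponential
  tail at level \<open>L = 3 ln A\<close> and the mixing coefficient beat the union bound over the
  \<open>J\<close> coordinates and the at most \<open>T\<close> classes.
\<close>

lemma prob_max_abs_sum_gt:
  fixes Z :: "nat \<Rightarrow> nat \<Rightarrow> 'a \<Rightarrow> real" and s v :: real
  assumes Z: "\<And>j t. j \<in> {1..J} \<Longrightarrow> t \<in> {1..T} \<Longrightarrow>
      integrable M (Z j t) \<and> expectation (Z j t) = 0"
    and Z2: "\<And>j t. j \<in> {1..J} \<Longrightarrow> t \<in> {1..T} \<Longrightarrow>
      integrable M (\<lambda>\<omega>. (Z j t \<omega>)\<^sup>2) \<and> expectation (\<lambda>\<omega>. (Z j t \<omega>)\<^sup>2) \<le> s"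
    and mixing: "\<And>j m. j \<in> {1..J} \<Longrightarrow> 1 \<le> m \<Longrightarrow>
      beta_mixing M T (Z j) m \<le> a1 * exp (- a2 * real m powr \<tau>)"
    and pos: "0 < a1" "0 < a2" "0 < \<tau>" "0 \<le> s" "0 \<le> v"
    and T: "1 \<le> T" and TJ: "3 \<le> max T J"
  shows "prob {\<omega> \<in> space M. \<exists>j\<in>{1..J}. (\<Sum>t=1..T. (Z j t \<omega>)\<^sup>2) \<le> v * real T \<and>
      score_constant a2 \<tau> s v * ln (real (max T J)) powr ((1 + \<tau>) / (2 * \<tau>)) * sqrt (real T)
        < \<bar>\<Sum>t=1..T. Z j t \<omega>\<bar>}
    \<le> 2 * (1 + a1) / real (max T J)"
proof -
  define A where "A = real (max T J)"
  \<comment> \<open>Here \<open>a2 * p powr \<tau> = 4 * ln A\<close>, so the mixing bound is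
    \<open>a1 * A powr (- 4)\<close>. It is multiplied by at most \<open>2 * J * T * T\<close>, and
    the exponential tail \<open>A powr (- 3)\<close> by at most \<open>2 * J * T\<close>; both leave
    order \<open>1 / A\<close>.\<close>
  define p where "p = (4 * ln A / a2) powr (1 / \<tau>)"
  define q where "q = nat \<lceil>p\<rceil>"
  define L where "L = 3 * ln A"
  define C where "C = (4 / a2) powr (1 / \<tau>) + 1"
  define r where "r = score_constant a2 \<tau> s v * ln A powr ((1 + \<tau>) / (2 * \<tau>)) * sqrt (real T)"
  have A: "3 \<le> A" "real T \<le> A" "real J \<le> A" using TJ by (auto simp: A_def)
  \<comment> \<open>This is where \<open>3 \<le> max T J\<close> enters:
    \<open>exp 1 \<le> 3\<close>. It lets the \<open>1\<close> lost by rounding \<open>p\<close> up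
    be absorbed into a multiple of \<open>ln A powr (1 / \<tau>)\<close>.\<close>
  have lnA: "1 \<le> ln A"
    using A(1) exp_le by (subst ln_ge_iff) auto
  have p: "0 < p" using lnA pos by (simp add: p_def)
  have q: "p \<le> real q" "real q \<le> p + 1" "1 \<le> q" using p unfolding q_def by linarith+
  have "(4 * ln A / a2) = p powr \<tau>" using lnA pos by (simp add: p_def powr_powr)
  also have "\<dots> \<le> real q powr \<tau>" using q p pos by (intro powr_mono2) auto
  finally have "4 * ln A \<le> a2 * real q powr \<tau>" using pos by (simp add: field_simps)
  then have "exp (- a2 * real q powr \<tau>) \<le> exp (- (4 * ln A))" by simp
  also have "\<dots> = A powr (- 4)" using A by (simp add: powr_def)
  finally have mixq: "a1 * exp (- a2 * real q powr \<tau>) \<le> a1 * A powr (- 4)"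
    using pos by (intro mult_left_mono) auto
  have p_eq: "p = (4 / a2) powr (1 / \<tau>) * ln A powr (1 / \<tau>)"
    using powr_mult[of "4 / a2" "ln A" "1 / \<tau>"] lnA pos by (simp add: p_def)
  have "1 \<le> ln A powr (1 / \<tau>)" using lnA pos by (simp add: ge_one_powr_ge_zero)
  then have qC: "real q \<le> C * ln A powr (1 / \<tau>)"
    using q(2) by (simp add: C_def p_eq distrib_right)
  \<comment> \<open>The class count contributes the power \<open>1 / \<tau>\<close> of
    \<open>ln A\<close> and the level \<open>L\<close> the power \<open>1\<close>; the root of the
    product has the exponent \<open>(1 + \<tau>) / (2 * \<tau>)\<close> of the rate.\<close>
  have "sqrt (real q * L * real T)
      \<le> sqrt (3 * C * (ln A powr ((1 + \<tau>) / (2 * \<tau>)))\<^sup>2 * real T)"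
  proof (intro real_sqrt_le_mono mult_right_mono)
    have "real q * L \<le> C * ln A powr (1 / \<tau>) * L"
      using qC lnA by (intro mult_right_mono) (auto simp: L_def)
    also have "\<dots> = 3 * C * (ln A powr (1 / \<tau>) * ln A powr 1)"
      using lnA by (simp add: L_def)
    also have "ln A powr (1 / \<tau>) * ln A powr 1 = ln A powr ((1 + \<tau>) / \<tau>)"
      using pos by (simp only: powr_add[symmetric]) (simp add: field_simps)
    also have "\<dots> = (ln A powr ((1 + \<tau>) / (2 * \<tau>)))\<^sup>2"
    proof -
      have "(1 + \<tau>) / (2 * \<tau>) * 2 = (1 + \<tau>) / \<tau>" using pos by (simp add: field_simps)
      then show ?thesis
        using lnA by (simp add: powr_powr flip: powr_numeral)
    qed
    finally show "real q * L \<le> 3 * C * (ln A powr ((1 + \<tau>) / (2 * \<tau>)))\<^sup>2" .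
  qed simp
  also have "\<dots> = sqrt (3 * C) * ln A powr ((1 + \<tau>) / (2 * \<tau>)) * sqrt (real T)"
    by (simp add: real_sqrt_mult)
  finally have "(v + s + 1) * sqrt (real q * L * real T)
      \<le> (v + s + 1) * (sqrt (3 * C) * ln A powr ((1 + \<tau>) / (2 * \<tau>)) * sqrt (real T))"
    using pos by (intro mult_left_mono) auto
  then have r: "(v + s + 1) * sqrt (real q * L * real T) \<le> r"
    by (simp add: r_def score_constant_def C_def mult_ac)
  define E where "E j = {\<omega> \<in> space M. (\<Sum>t=1..T. (Z j t \<omega>)\<^sup>2) \<le> v * real T \<and>
      r < \<bar>\<Sum>t=1..T. Z j t \<omega>\<bar>}" for j
  have Zm [measurable]: "Z j t \<in> borel_measurable M" if "j \<in> {1..J}" "t \<in> {1..T}" for j t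
    using Z[OF that] by auto
  have Em: "E j \<in> events" if [measurable]: "j \<in> {1..J}" for j unfolding E_def by measurable
  have E: "prob (E j) \<le> 2 * (1 + a1) * A powr (- 2)" if j: "j \<in> {1..J}" for j
  proof -
    have B: "beta_mixing M T (Z j) q \<le> a1 * A powr (- 4)"
      using mixing[OF j q(3)] mixq by simp
    have "prob (E j) \<le> prob {\<omega> \<in> space M. (\<Sum>t=1..T. (Z j t \<omega>)\<^sup>2) \<le> v * real T \<and>
        (v + s + 1) * sqrt (real q * L * real T) < \<bar>\<Sum>t=1..T. Z j t \<omega>\<bar>}"
      using r j unfolding E_def by (intro finite_measure_mono) auto
    also have "\<dots> \<le> 2 * real T * (exp (- L) + real T * (a1 * A powr (- 4)))"
      using lnA pos by (intro prob_abs_sum_gt[OF Z[OF j] Z2[OF j] B _ q(3) _ T]) (auto simp: L_def)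
    also have "\<dots> \<le> 2 * A * (exp (- L) + A * (a1 * A powr (- 4)))"
      using A pos by (intro mult_mono add_mono) auto
    also have "exp (- L) = A powr (- 3)" using A by (simp add: L_def powr_def)
    also have "2 * A * (A powr (- 3) + A * (a1 * A powr (- 4))) = 2 * (1 + a1) * A powr (- 2)"
      using A by (simp add: powr_minus field_simps power2_eq_square eval_nat_numeral)
    finally show ?thesis .
  qed
  have "prob (\<Union>j\<in>{1..J}. E j) \<le> (\<Sum>j=1..J. prob (E j))"
    using Em by (intro finite_measure_subadditive_finite) auto
  also have "\<dots> \<le> real J * (2 * (1 + a1) * A powr (- 2))"
    using sum_bounded_above[of "{1..J}", OF E] by simp
  also have "\<dots> \<le> A * (2 * (1 + a1) * A powr (- 2))"
    using A pos by (intro mult_right_mono) auto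
  also have "\<dots> = 2 * (1 + a1) / A"
    using A by (simp add: powr_minus field_simps power2_eq_square eval_nat_numeral)
  also have "(\<Union>j\<in>{1..J}. E j) = {\<omega> \<in> space M. \<exists>j\<in>{1..J}.
      (\<Sum>t=1..T. (Z j t \<omega>)\<^sup>2) \<le> v * real T \<and> r < \<bar>\<Sum>t=1..T. Z j t \<omega>\<bar>}"
    by (auto simp: E_def)
  finally show ?thesis by (simp only: r_def A_def)
qed

end

subsection \<open>The prediction error\<close>

lemma mat_vec_diff:
  "mat_vec J x (\<lambda>j. a j - b j) t = mat_vec J x a t - mat_vec J x b t"
  by (simp add: mat_vec_def right_diff_distrib sum_subtractf)

lemma L2_set_power2: "(L2_set f S)\<^sup>2 = (\<Sum>t\<in>S. (f t)\<^sup>2)"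
  by (simp add: L2_set_def sum_nonneg)

text \<open>The basic inequality of least squares, then duality of the l1 and maximum norms. In the
  constant \<open>4\<close>, one factor \<open>2\<close> is from the cross term and one from the
  triangle inequality for \<open>a - b\<close>.\<close>

lemma prediction_error_le:
  fixes x :: "nat \<Rightarrow> nat \<Rightarrow> real"
  assumes min: "L2_set (\<lambda>t. y t - mat_vec J x a t) S \<le> L2_set (\<lambda>t. y t - mat_vec J x b t) S"
    and y: "\<And>t. t \<in> S \<Longrightarrow> y t = mat_vec J x b t + e t"
    and score: "\<And>j. j \<in> {1..J} \<Longrightarrow> \<bar>\<Sum>t\<in>S. x j t * e t\<bar> \<le> G"
    and l1: "l1_norm J a \<le> k" "l1_norm J b \<le> k" and G: "0 \<le> G"
  shows "(L2_set (mat_vec J x (\<lambda>j. a j - b j)) S)\<^sup>2 \<le> 4 * k * G"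
proof -
  define d where "d = (\<lambda>j. a j - b j)"
  have yd: "y t - mat_vec J x a t = e t - mat_vec J x d t" "y t - mat_vec J x b t = e t"
    if "t \<in> S" for t
    using y[OF that] by (simp_all add: d_def mat_vec_diff)
  have "(\<Sum>t\<in>S. (y t - mat_vec J x a t)\<^sup>2) \<le> (\<Sum>t\<in>S. (y t - mat_vec J x b t)\<^sup>2)"
    using power_mono[OF min L2_set_nonneg, of 2] by (simp only: L2_set_power2)
  then have "(\<Sum>t\<in>S. (e t - mat_vec J x d t)\<^sup>2) \<le> (\<Sum>t\<in>S. (e t)\<^sup>2)"
    by (simp add: yd)
  then have "(\<Sum>t\<in>S. (mat_vec J x d t)\<^sup>2) \<le> 2 * (\<Sum>t\<in>S. e t * mat_vec J x d t)"
    by (simp add: power2_diff sum.distrib sum_subtractf sum_distrib_left mult.assoc)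
  also have "(\<Sum>t\<in>S. e t * mat_vec J x d t) = (\<Sum>j=1..J. d j * (\<Sum>t\<in>S. x j t * e t))"
    unfolding mat_vec_def sum_distrib_left by (subst sum.swap) (simp add: mult_ac)
  also have "\<dots> \<le> (\<Sum>j=1..J. \<bar>d j\<bar> * G)"
  proof (rule sum_mono)
    fix j assume "j \<in> {1..J}"
    then have "\<bar>d j\<bar> * \<bar>\<Sum>t\<in>S. x j t * e t\<bar> \<le> \<bar>d j\<bar> * G"
      using score by (intro mult_left_mono) auto
    then show "d j * (\<Sum>t\<in>S. x j t * e t) \<le> \<bar>d j\<bar> * G"
      unfolding abs_mult[symmetric] by (rule abs_le_D1)
  qed
  also have "\<dots> \<le> (\<Sum>j=1..J. (\<bar>a j\<bar> + \<bar>b j\<bar>) * G)"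
    using G by (intro sum_mono mult_right_mono) (auto simp: d_def abs_triangle_ineq4)
  also have "\<dots> = (l1_norm J a + l1_norm J b) * G"
    by (simp add: l1_norm_def sum.distrib flip: sum_distrib_right)
  also have "\<dots> \<le> (k + k) * G" using l1 G by (intro mult_right_mono) auto
  finally show ?thesis by (simp add: L2_set_power2 d_def)
qed

section \<open>From high probability to convergence in probability\<close>

text \<open>Once \<open>b n\<close> is below \<open>\<epsilon>\<^sup>2\<close>, a deviation above
  \<open>\<epsilon>\<close> forces \<open>E\<close> or \<open>F\<close> to fail. Two events are
  allowed so that the error bound can be combined with the condition on the design.\<close>

lemma oP1_of_square_le:
  fixes Z :: "nat \<Rightarrow> 'a \<Rightarrow> real"
  assumes \<Omega>: "\<And>n. prob_space (\<Omega> n)"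
    and Z: "\<And>n. Z n \<in> borel_measurable (\<Omega> n)"
    and E: "whp \<Omega> E" and F: "whp \<Omega> F"
    and le: "\<And>n \<omega>. \<omega> \<in> space (\<Omega> n) \<Longrightarrow> E n \<omega> \<Longrightarrow> F n \<omega> \<Longrightarrow> (Z n \<omega>)\<^sup>2 \<le> b n"
    and b: "b \<longlonglongrightarrow> 0"
  shows "oP1 \<Omega> Z"
  unfolding oP1_def
proof (intro allI impI)
  fix \<epsilon> :: real assume \<epsilon>: "0 < \<epsilon>"
  \<comment> \<open>\<open>whp\<close> does not state that its events are measurable. A set that is
    not measurable has \<open>measure\<close> zero, so probabilities tending to one make the events
    measurable eventually.\<close>
  have meas: "\<forall>\<^sub>F n in sequentially. {\<omega> \<in> space (\<Omega> n). G n \<omega>} \<in> sets (\<Omega> n)"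
    if "whp \<Omega> G" for G
  proof -
    have "\<forall>\<^sub>F n in sequentially. 0 < measure (\<Omega> n) {\<omega> \<in> space (\<Omega> n). G n \<omega>}"
      using that unfolding whp_def by (rule order_tendstoD) simp
    then show ?thesis
    proof eventually_elim
      case (elim n)
      then show ?case using measure_notin_sets[of "{\<omega> \<in> space (\<Omega> n). G n \<omega>}" "\<Omega> n"] by force
    qed
  qed
  have "\<forall>\<^sub>F n in sequentially. b n < \<epsilon>\<^sup>2" using b \<epsilon> by (intro order_tendstoD) auto
  with meas[OF E] meas[OF F]
  have upper: "\<forall>\<^sub>F n in sequentially. measure (\<Omega> n) {\<omega> \<in> space (\<Omega> n). \<epsilon> < \<bar>Z n \<omega>\<bar>}
    \<le> (1 - measure (\<Omega> n) {\<omega> \<in> space (\<Omega> n). E n \<omega>})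
      + (1 - measure (\<Omega> n) {\<omega> \<in> space (\<Omega> n). F n \<omega>})"
  proof eventually_elim
    case (elim n)
    interpret prob_space "\<Omega> n" by fact
    have "prob {\<omega> \<in> space (\<Omega> n). \<epsilon> < \<bar>Z n \<omega>\<bar>}
      \<le> prob ((space (\<Omega> n) - {\<omega> \<in> space (\<Omega> n). E n \<omega>}) \<union> (space (\<Omega> n) - {\<omega> \<in> space (\<Omega> n). F n \<omega>}))"
    proof (intro finite_measure_mono subsetI)
      fix \<omega> assume \<omega>: "\<omega> \<in> {\<omega> \<in> space (\<Omega> n). \<epsilon> < \<bar>Z n \<omega>\<bar>}"
      have "\<not> (E n \<omega> \<and> F n \<omega>)"
      proof
        assume "E n \<omega> \<and> F n \<omega>"
        then have "(Z n \<omega>)\<^sup>2 \<le> b n" using le[of \<omega> n] \<omega> by simp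
        also have "\<dots> < \<epsilon>\<^sup>2" by fact
        finally have "\<bar>Z n \<omega>\<bar>\<^sup>2 < \<epsilon>\<^sup>2" by simp
        then have "\<bar>Z n \<omega>\<bar> < \<epsilon>" by (rule power2_less_imp_less) (use \<epsilon> in simp)
        then show False using \<omega> by simp
      qed
      then show "\<omega> \<in> (space (\<Omega> n) - {\<omega> \<in> space (\<Omega> n). E n \<omega>})
          \<union> (space (\<Omega> n) - {\<omega> \<in> space (\<Omega> n). F n \<omega>})"
        using \<omega> by auto
    qed (use elim in auto)
    also have "\<dots> \<le> prob (space (\<Omega> n) - {\<omega> \<in> space (\<Omega> n). E n \<omega>})
        + prob (space (\<Omega> n) - {\<omega> \<in> space (\<Omega> n). F n \<omega>})"
      using elim by (intro measure_Un_le) auto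
    finally show ?case using elim by (simp only: prob_compl)
  qed
  have lim: "(\<lambda>n. (1 - measure (\<Omega> n) {\<omega> \<in> space (\<Omega> n). E n \<omega>})
      + (1 - measure (\<Omega> n) {\<omega> \<in> space (\<Omega> n). F n \<omega>})) \<longlonglongrightarrow> 0"
    using tendsto_add[OF tendsto_diff[OF tendsto_const E[unfolded whp_def], of 1]
        tendsto_diff[OF tendsto_const F[unfolded whp_def], of 1]] by simp
  show "(\<lambda>n. measure (\<Omega> n) {\<omega> \<in> space (\<Omega> n). \<epsilon> < \<bar>Z n \<omega>\<bar>}) \<longlonglongrightarrow> 0"
    by (rule tendsto_sandwich[OF _ upper tendsto_const lim]) simp
qed

section \<open>The error bound for the regression array\<close>

text \<open>The factor \<open>4\<close> comes from \<open>prediction_error_le\<close>,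
  \<open>1 + c2\<close> bounds the second moments of the scores and \<open>c3\<^sup>2\<close> their
  average squares. \<open>\<bar>Kb\<bar> + 1\<close> bounds the radius and stays positive for every
  \<open>Kb\<close>.\<close>

definition rate_constant :: "real \<Rightarrow> real \<Rightarrow> real \<Rightarrow> real \<Rightarrow> real \<Rightarrow> real" where
  "rate_constant Kb c2 c3 a2 \<tau> = 4 * (\<bar>Kb\<bar> + 1) * score_constant a2 \<tau> (1 + c2) (c3\<^sup>2)"

lemma score_constant_pos: "0 \<le> s \<Longrightarrow> 0 \<le> v \<Longrightarrow> 0 < score_constant a2 \<tau> s v"
  unfolding score_constant_def by (intro mult_pos_pos) (auto intro: add_nonneg_pos)

context regression_array
begin

lemma l1_norm_le_Kb: "v \<in> W n \<Longrightarrow> l1_norm (J n) v \<le> Kb"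
  using W_bounded[of n] K_bounded[of n] by force

lemma wh_in_W: "\<omega> \<in> space (\<Omega> n) \<Longrightarrow> wh n \<omega> \<in> W n"
  using wh_arg_min by (simp add: is_arg_min_def)

lemma measurable_score:
  assumes "j \<in> {1..J n}" "t \<in> {1..T n}"
  shows "(\<lambda>\<omega>. X n \<omega> j t * u n \<omega> t) \<in> borel_measurable (\<Omega> n)"
  using X_measurable[OF assms] u_measurable[OF assms(2)] by (rule borel_measurable_times)

text \<open>Both parts follow from \<open>x\<^sup>2 \<le> 1 + \<bar>x\<bar> ^ 3\<close>, which also
  avoids a fractional power of \<open>c2\<close>.\<close>

lemma score_second_moment:
  assumes "j \<in> {1..J n}" "t \<in> {1..T n}"
  shows "integrable (\<Omega> n) (\<lambda>\<omega>. (X n \<omega> j t * u n \<omega> t)\<^sup>2)"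
    and "(\<integral>\<omega>. (X n \<omega> j t * u n \<omega> t)\<^sup>2 \<partial>\<Omega> n) \<le> 1 + c2"
proof -
  interpret prob_space "\<Omega> n" by (rule prob_space)
  let ?h = "\<lambda>\<omega>. 1 + \<bar>X n \<omega> j t * u n \<omega> t\<bar> ^ 3"
  have le: "x\<^sup>2 \<le> 1 + \<bar>x\<bar> ^ 3" for x :: real
  proof (cases "\<bar>x\<bar> \<le> 1")
    case True
    then have "\<bar>x\<bar>\<^sup>2 \<le> 1" by (intro power_le_one) auto
    then show ?thesis by (simp add: add_increasing2)
  next
    case False
    then have "\<bar>x\<bar>\<^sup>2 \<le> \<bar>x\<bar> ^ 3" by (intro power_increasing) auto
    then show ?thesis by simp
  qed
  have h: "integrable (\<Omega> n) ?h" "expectation ?h \<le> 1 + c2"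
    using third_moment[OF assms] by (auto simp: prob_space)
  note measurable_score[OF assms, measurable]
  show i: "integrable (\<Omega> n) (\<lambda>\<omega>. (X n \<omega> j t * u n \<omega> t)\<^sup>2)"
    by (rule Bochner_Integration.integrable_bound[OF h(1)])
      (auto intro!: AE_I2 le)
  show "expectation (\<lambda>\<omega>. (X n \<omega> j t * u n \<omega> t)\<^sup>2) \<le> 1 + c2"
    using integral_mono[OF i h(1) le] h(2) by linarith
qed

lemma measurable_mat_vec:
  assumes "\<And>j. j \<in> {1..J n} \<Longrightarrow> (\<lambda>\<omega>. v \<omega> j) \<in> borel_measurable (\<Omega> n)" "t \<in> {1..T n}"
  shows "(\<lambda>\<omega>. mat_vec (J n) (X n \<omega>) (v \<omega>) t) \<in> borel_measurable (\<Omega> n)"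
  unfolding mat_vec_def using assms X_measurable
  by (intro borel_measurable_sum borel_measurable_times) auto

lemma measurable_prediction_error:
  "t \<in> {1..T n} \<Longrightarrow>
    (\<lambda>\<omega>. mat_vec (J n) (X n \<omega>) (\<lambda>j. wh n \<omega> j - w n j) t) \<in> borel_measurable (\<Omega> n)"
  using wh_measurable by (intro measurable_mat_vec) auto

lemma T_infinity: "filterlim T at_top sequentially"
  by (rule filterlim_at_top_mono[OF T0_infinity]) (simp add: T_eq)

text \<open>The event of controlled squares is contained, up to an exceptional event of probability
  of order \<open>1 / T\<close>, in the event that the error bound holds.\<close>

lemma whp_prediction_error:
  assumes pos: "0 < c2" "0 < a1" "0 < a2" "0 < \<tau>"
  shows "whp \<Omega> (\<lambda>n \<omega>.
    (L2_set (mat_vec (J n) (X n \<omega>) (\<lambda>j. wh n \<omega> j - w n j)) {1..T n})\<^sup>2 / real (T n)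
      \<le> rate (rate_constant Kb c2 c3 a2 \<tau>) \<tau> (T n) (J n))"
proof -
  define C where "C = score_constant a2 \<tau> (1 + c2) (c3\<^sup>2)"
  define r where "r n = C * ln (real (max (T n) (J n))) powr ((1 + \<tau>) / (2 * \<tau>)) * sqrt (real (T n))"
    for n
  define E where "E n \<omega> \<longleftrightarrow>
    (L2_set (mat_vec (J n) (X n \<omega>) (\<lambda>j. wh n \<omega> j - w n j)) {1..T n})\<^sup>2 / real (T n)
      \<le> rate (rate_constant Kb c2 c3 a2 \<tau>) \<tau> (T n) (J n)" for n \<omega>
  define S where "S n \<omega> \<longleftrightarrow> (\<forall>j\<in>{1..J n}.
    (\<Sum>t=1..T n. (X n \<omega> j t)\<^sup>2 * (u n \<omega> t)\<^sup>2) \<le> c3\<^sup>2 * real (T n))" for n \<omega>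
  have C: "0 < C" using pos unfolding C_def by (intro score_constant_pos) auto
  then have r: "0 \<le> r n" for n by (simp add: r_def)
  have "\<forall>\<^sub>F n in sequentially. 3 \<le> T n"
    using T_infinity by (simp add: filterlim_at_top)
  then have lower: "\<forall>\<^sub>F n in sequentially.
    measure (\<Omega> n) {\<omega> \<in> space (\<Omega> n). S n \<omega>} - 2 * (1 + a1) / real (T n)
      \<le> measure (\<Omega> n) {\<omega> \<in> space (\<Omega> n). E n \<omega>}"
  proof eventually_elim
    case (elim n)
    interpret prob_space "\<Omega> n" by (rule prob_space)
    \<comment> \<open>The condition on the squares is part of \<open>B\<close>, coordinate by
      coordinate, to match the tail bound; on \<open>S n\<close> outside \<open>B\<close> every
      score is at most \<open>r n\<close>.\<close>
    define B where "B = {\<omega> \<in> space (\<Omega> n). \<exists>j\<in>{1..J n}.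
      (\<Sum>t=1..T n. (X n \<omega> j t * u n \<omega> t)\<^sup>2) \<le> c3\<^sup>2 * real (T n) \<and>
      r n < \<bar>\<Sum>t=1..T n. X n \<omega> j t * u n \<omega> t\<bar>}"
    have "prob B \<le> 2 * (1 + a1) / real (max (T n) (J n))"
      unfolding B_def r_def C_def
      using elim pos score_second_moment mean_zero mixing
      by (intro prob_max_abs_sum_gt) (auto simp: mult.commute)
    also have "\<dots> \<le> 2 * (1 + a1) / real (T n)"
      using elim pos by (intro divide_left_mono) auto
    finally have B: "prob B \<le> 2 * (1 + a1) / real (T n)" .
    note measurable_score [measurable]
    have B_event: "B \<in> events" unfolding B_def by measurable
    have [measurable]: "(\<lambda>\<omega>. (mat_vec (J n) (X n \<omega>) (\<lambda>j. wh n \<omega> j - w n j) t)\<^sup>2)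
        \<in> borel_measurable (\<Omega> n)" if "t \<in> {1..T n}" for t
      using measurable_prediction_error[OF that] by measurable
    have E_event: "{\<omega> \<in> space (\<Omega> n). E n \<omega>} \<in> events"
      unfolding E_def L2_set_power2 by measurable
    have "prob {\<omega> \<in> space (\<Omega> n). S n \<omega>} \<le> prob ({\<omega> \<in> space (\<Omega> n). E n \<omega>} \<union> B)"
    proof (intro finite_measure_mono subsetI)
      fix \<omega> assume "\<omega> \<in> {\<omega> \<in> space (\<Omega> n). S n \<omega>}"
      then have \<omega>: "\<omega> \<in> space (\<Omega> n)" "S n \<omega>" by auto
      have "E n \<omega>" if "\<omega> \<notin> B"
      proof -
        have score: "\<bar>\<Sum>t=1..T n. X n \<omega> j t * u n \<omega> t\<bar> \<le> r n" if "j \<in> {1..J n}" for j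
          using \<open>\<omega> \<notin> B\<close> \<omega> that by (force simp: B_def S_def power_mult_distrib not_less)
        have "L2_set (\<lambda>t. Y n \<omega> t - mat_vec (J n) (X n \<omega>) (wh n \<omega>) t) {1..T n}
            \<le> L2_set (\<lambda>t. Y n \<omega> t - mat_vec (J n) (X n \<omega>) (w n) t) {1..T n}"
          using wh_arg_min[OF \<omega>(1)] w_in_W[of n] by (auto simp: is_arg_min_linorder)
        then have "(L2_set (mat_vec (J n) (X n \<omega>) (\<lambda>j. wh n \<omega> j - w n j)) {1..T n})\<^sup>2
            \<le> 4 * Kb * r n"
          by (rule prediction_error_le[OF _ model[OF \<omega>(1)] score])
            (auto simp: l1_norm_le_Kb wh_in_W[OF \<omega>(1)] w_in_W r)
        also have "\<dots> \<le> 4 * (\<bar>Kb\<bar> + 1) * r n"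
          using r by (intro mult_right_mono) auto
        finally have "(L2_set (mat_vec (J n) (X n \<omega>) (\<lambda>j. wh n \<omega> j - w n j)) {1..T n})\<^sup>2 / real (T n)
            \<le> 4 * (\<bar>Kb\<bar> + 1) * r n / real (T n)"
          by (rule divide_right_mono) simp
        also have "\<dots> = rate_constant Kb c2 c3 a2 \<tau>
            * ln (real (max (T n) (J n))) powr ((1 + \<tau>) / (2 * \<tau>)) * (sqrt (real (T n)) / real (T n))"
          by (simp add: r_def rate_constant_def C_def)
        also have "sqrt (real (T n)) / real (T n) = real (T n) powr (- 1 / 2)"
          using powr_minus[of "real (T n)" "1 / 2"] by (simp add: powr_half_sqrt sqrt_divide_self_eq)
        finally show ?thesis by (simp add: E_def rate_def)
      qed
      then show "\<omega> \<in> {\<omega> \<in> space (\<Omega> n). E n \<omega>} \<union> B" using \<omega> by auto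
    qed (use B_event E_event in auto)
    also have "\<dots> \<le> prob {\<omega> \<in> space (\<Omega> n). E n \<omega>} + prob B"
      using B_event E_event by (intro measure_Un_le) auto
    finally show ?case using B by simp
  qed
  have "(\<lambda>n. 2 * (1 + a1) / real (T n)) \<longlonglongrightarrow> 0"
    by (intro tendsto_divide_0[OF tendsto_const] filterlim_at_top_imp_at_infinity
      filterlim_compose[OF filterlim_real_sequentially T_infinity])
  then have lim: "(\<lambda>n. measure (\<Omega> n) {\<omega> \<in> space (\<Omega> n). S n \<omega>} - 2 * (1 + a1) / real (T n)) \<longlonglongrightarrow> 1"
    using tendsto_diff[OF sum_squares[unfolded whp_def]] unfolding S_def by fastforce
  have "(\<lambda>n. measure (\<Omega> n) {\<omega> \<in> space (\<Omega> n). E n \<omega>}) \<longlonglongrightarrow> 1"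
    by (rule tendsto_sandwich[OF lower _ lim tendsto_const])
      (simp add: prob_space.prob_le_1[OF prob_space])
  then show ?thesis by (simp add: whp_def E_def)
qed

end

theorem lemma1:
  fixes Kb c1 c2 c3 a1 a2 \<tau> :: real
  assumes "c1 > 0" "c2 > 0" "c3 > 0" "a1 > 0" "a2 > 0" "\<tau> > 0"
  shows "\<exists>M>0. \<forall>(\<Omega> :: nat \<Rightarrow> 'a measure) T0 Ts T J X u Y K W w wh.
    regression_array Kb c1 c2 c3 a1 a2 \<tau> \<Omega> T0 Ts T J X u Y K W w wh \<longrightarrow>
      whp \<Omega> (\<lambda>n \<omega>.
        (L2_set (mat_vec (J n) (X n \<omega>) (\<lambda>j. wh n \<omega> j - w n j)) {1..T n})\<^sup>2 / real (T n)
          \<le> rate M \<tau> (T n) (J n)) \<and>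
      (\<forall>l :: nat \<Rightarrow> real.
        (\<forall>n. l n > 0) \<longrightarrow>
        whp \<Omega> (\<lambda>n \<omega>. \<forall>\<delta>\<in>Rvec (J n). (\<lambda>j. w n j + \<delta> j) \<in> W n \<longrightarrow>
          (\<forall>t\<in>{T0 n + 1..T n}. (mat_vec (J n) (X n \<omega>) \<delta> t)\<^sup>2
            \<le> l n * (L2_set (mat_vec (J n) (X n \<omega>) \<delta>) {1..T n})\<^sup>2 / real (T n))) \<longrightarrow>
        (\<lambda>n. l n * rate M \<tau> (T n) (J n)) \<longlonglongrightarrow> 0 \<longrightarrow>
          ((\<lambda>n. rate M \<tau> (T n) (J n)) \<longlonglongrightarrow> 0 \<longrightarrow>
            oP1 \<Omega> (\<lambda>n \<omega>. 1 / real (T n) *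
              (\<Sum>t=1..T n. (mat_vec (J n) (X n \<omega>) (wh n \<omega>) t
                - mat_vec (J n) (X n \<omega>) (w n) t)\<^sup>2))) \<and>
          (\<forall>t :: nat \<Rightarrow> nat. (\<forall>n. t n \<in> {T0 n + 1..T n}) \<longrightarrow>
            oP1 \<Omega> (\<lambda>n \<omega>. mat_vec (J n) (X n \<omega>) (wh n \<omega>) (t n)
              - mat_vec (J n) (X n \<omega>) (w n) (t n))))"
proof (intro exI conjI allI impI)
  \<comment> \<open>This instantiates the witness for \<open>M\<close>. It is built from the
    constants alone, before any array is fixed, so one \<open>M\<close> serves all arrays.\<close>
  show "0 < rate_constant Kb c2 c3 a2 \<tau>"
    unfolding rate_constant_def using assms by (intro mult_pos_pos score_constant_pos) auto
  fix \<Omega> :: "nat \<Rightarrow> 'a measure" and T0 Ts T J X u Y K W w wh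
  assume "regression_array Kb c1 c2 c3 a1 a2 \<tau> \<Omega> T0 Ts T J X u Y K W w wh"
  then interpret regression_array Kb c1 c2 c3 a1 a2 \<tau> \<Omega> T0 Ts T J X u Y K W w wh .
  let ?rate = "\<lambda>n. rate (rate_constant Kb c2 c3 a2 \<tau>) \<tau> (T n) (J n)"
  let ?e = "\<lambda>n \<omega>. mat_vec (J n) (X n \<omega>) (\<lambda>j. wh n \<omega> j - w n j)"
  show E: "whp \<Omega> (\<lambda>n \<omega>. (L2_set (?e n \<omega>) {1..T n})\<^sup>2 / real (T n) \<le> ?rate n)"
    using assms by (intro whp_prediction_error)
  note [measurable] = measurable_prediction_error
  \<comment> \<open>The average is the left side of \<open>E\<close>, hence at most
    \<open>?rate n\<close> with high probability; \<open>E\<close> fills both event slots. The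
    premise \<open>?rate \<longlonglongrightarrow> 0\<close> is separate because \<open>l\<close>
    may tend to zero, so that \<open>l n * ?rate n\<close> vanishes without it.\<close>
  show "oP1 \<Omega> (\<lambda>n \<omega>. 1 / real (T n) *
      (\<Sum>t=1..T n. (mat_vec (J n) (X n \<omega>) (wh n \<omega>) t - mat_vec (J n) (X n \<omega>) (w n) t)\<^sup>2))"
    if "?rate \<longlonglongrightarrow> 0"
    unfolding mat_vec_diff[symmetric]
  proof (rule oP1_of_square_le[OF prob_space _ E E])
    show "(\<lambda>n. (?rate n)\<^sup>2) \<longlonglongrightarrow> 0" using tendsto_power[OF that, of 2] by simp
    show "(\<lambda>\<omega>. 1 / real (T n) * (\<Sum>t=1..T n. (?e n \<omega> t)\<^sup>2)) \<in> borel_measurable (\<Omega> n)" for n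
      by measurable
    show "(1 / real (T n) * (\<Sum>t=1..T n. (?e n \<omega> t)\<^sup>2))\<^sup>2 \<le> (?rate n)\<^sup>2"
      if "(L2_set (?e n \<omega>) {1..T n})\<^sup>2 / real (T n) \<le> ?rate n" for n \<omega>
      using that by (intro power_mono) (auto simp: L2_set_power2 sum_nonneg)
  qed
  fix l :: "nat \<Rightarrow> real" and t :: "nat \<Rightarrow> nat"
  assume l: "\<forall>n. l n > 0" and t: "\<forall>n. t n \<in> {T0 n + 1..T n}"
    and F: "whp \<Omega> (\<lambda>n \<omega>. \<forall>\<delta>\<in>Rvec (J n). (\<lambda>j. w n j + \<delta> j) \<in> W n \<longrightarrow>
          (\<forall>t\<in>{T0 n + 1..T n}. (mat_vec (J n) (X n \<omega>) \<delta> t)\<^sup>2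
            \<le> l n * (L2_set (mat_vec (J n) (X n \<omega>) \<delta>) {1..T n})\<^sup>2 / real (T n)))"
    and lim: "(\<lambda>n. l n * ?rate n) \<longlonglongrightarrow> 0"
  show "oP1 \<Omega> (\<lambda>n \<omega>. mat_vec (J n) (X n \<omega>) (wh n \<omega>) (t n)
      - mat_vec (J n) (X n \<omega>) (w n) (t n))"
    unfolding mat_vec_diff[symmetric]
  proof (rule oP1_of_square_le[OF prob_space _ E F _ lim])
    have "t n \<in> {1..T n}" for n using t[rule_format, of n] by auto
    then show "(\<lambda>\<omega>. ?e n \<omega> (t n)) \<in> borel_measurable (\<Omega> n)" for n
      by (rule measurable_prediction_error)
    fix n \<omega>
    assume \<omega>: "\<omega> \<in> space (\<Omega> n)"
      and E: "(L2_set (?e n \<omega>) {1..T n})\<^sup>2 / real (T n) \<le> ?rate n"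
      and F: "\<forall>\<delta>\<in>Rvec (J n). (\<lambda>j. w n j + \<delta> j) \<in> W n \<longrightarrow>
          (\<forall>t\<in>{T0 n + 1..T n}. (mat_vec (J n) (X n \<omega>) \<delta> t)\<^sup>2
            \<le> l n * (L2_set (mat_vec (J n) (X n \<omega>) \<delta>) {1..T n})\<^sup>2 / real (T n))"
    \<comment> \<open>\<open>F\<close> is applied to the difference of \<open>wh n \<omega>\<close>
      and \<open>w n\<close>: it vanishes off \<open>{1..J n}\<close> as both vectors do, and adding
      \<open>w n\<close> gives back the estimator, which lies in \<open>W n\<close>.\<close>
    have "wh n \<omega> \<in> Rvec (J n)" "w n \<in> Rvec (J n)"
      using wh_in_W[OF \<omega>] w_in_W W_bounded by blast+
    then have "(\<lambda>j. wh n \<omega> j - w n j) \<in> Rvec (J n)" by (simp add: Rvec_def)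
    with F have "(?e n \<omega> (t n))\<^sup>2 \<le> l n * (L2_set (?e n \<omega>) {1..T n})\<^sup>2 / real (T n)"
      using wh_in_W[OF \<omega>] t by simp
    also have "\<dots> \<le> l n * ?rate n"
      using mult_left_mono[OF E, of "l n"] l by (simp add: less_imp_le)
    finally show "(?e n \<omega> (t n))\<^sup>2 \<le> l n * ?rate n" .
  qed
qed

end
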